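(* Let $p$ be a strictly monotone lattice norm on $\mathbb{R}^2$ with $p((1,0))=p((0,1))=1$, and let $\Phi$ be an Orlicz function. Consider: (i) $a(\Phi)=0$ and $\Phi$ satisfies the suitable $\Delta_2$-condition; (ii) $(L^\Phi(\mu),\|\cdot\|_{\Phi,p})$ is uniformly monotone; (iii) $(L^\Phi(\mu),\|\cdot\|_{\Phi,p})$ is upper locally uniformly monotone; (iv) $(E^\Phi(\mu),\|\cdot\|_{\Phi,p})$ is upper locally uniformly monotone. Then (i)$\Rightarrow$(ii)$\Rightarrow$(iii)$\Rightarrow$(iv). If additionally $K(x)\neq\emptyset$ for every $x\in E^\Phi(\mu)\setminus\{0\}$, then (iv)$\Rightarrow$(i), so all four conditions are equivalent.
   Context: $(\Omega,\Sigma,\mu)$ is a $\sigma$-finite complete measure space of one of the following types: non-atomic; $\Omega=\mathbb{N}$ with counting measure; or the union of a non-atomic part $\Omega_{na}$ with $\mu(\Omega_{na})>0$ and a finite or countably infinite set of atoms, each of measure $1$. $L^0$ is the space of (classes of a.e. equal) real measurable functions, ordered pointwise a.e. An Orlicz function is a function $\Phi:\mathbb{R}\to[0,\infty)$ which is convex, even, vanishes at $0$ and is not identically zero; $a(\Phi)=\sup\{u\ge0:\Phi(u)=0\}$. $I_\Phi(x)=\int_\Omega\Phi(x(t))\,d\mu\in[0,+\infty]$; $L^\Phi(\mu)=\{x\in L^0: I_\Phi(\lambda x)<\infty\text{ for some }\lambda>0\}$; $E^\Phi(\mu)=\{x\in L^0: I_\Phi(\lambda x)<\infty\text{ for all }\lambda>0\}$.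 A lattice norm on $\mathbb{R}^2$ is a norm $p$ with $p((u,v))\le p((u',v'))$ whenever $|u|\le|u'|,|v|\le|v'|$; it is strictly monotone if $0\le X\le Y$ coordinatewise and $X\ne Y$ imply $p(X)<p(Y)$. $\|x\|_{\Phi,p}=\inf_{k>0}\frac1k p((1,I_\Phi(kx)))$ with the convention $p((1,+\infty))=+\infty$; $K(x)=\{k\in(0,\infty):\|x\|_{\Phi,p}=\frac1k p((1,I_\Phi(kx)))\}$. $\Phi\in\Delta_2(\mathbb{R}_+)$ means $\exists K>0$: $\Phi(2u)\le K\Phi(u)$ for all $u\ge0$; $\Phi\in\Delta_2(\infty)$ means $\exists u_0,K>0$: $\Phi(2u)\le K\Phi(u)$ for $u\ge u_0$; $\Phi\in\Delta_2(0)$ means $\exists u_0,K>0$: $\Phi(2u)\le K\Phi(u)$ for $u\in[0,u_0]$. The suitable $\Delta_2$-condition is: $\Delta_2(\mathbb{R}_+)$ if $\mu$ is non-atomic and infinite; $\Delta_2(\infty)$ if $\mu$ is non-atomic and finite; $\Delta_2(0)$ for the counting measure on $\mathbb{N}$; for $\mu(\Omega_{na})>0$ with finitely many atoms, the condition suitable for $\Omega_{na}$; for $\mu(\Omega_{na})>0$ with countably infinitely many atoms, the conjunction of the condition suitable for $\Omega_{na}$ and $\Delta_2(0)$. A Banach lattice $X$ (with positive cone $X_+$) is uniformly monotone if for every $\varepsilon\in(0,1)$ there is $\delta(\varepsilon)\in(0,1)$ such that $0\le x\le y$, $\|x\|\ge\varepsilon$, $\|y\|=1$ imply $\|y-x\|\le1-\delta(\varepsilon)$;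 $X$ is upper locally uniformly monotone if for every $y\in X_+$ with $\|y\|=1$ and every $\varepsilon>0$ there is $\sigma(y,\varepsilon)>0$ such that every $x\in X_+$ with $\|x\|\ge\varepsilon$ satisfies $\|y+x\|\ge1+\sigma(y,\varepsilon)$. *)

theory Defs
  imports "HOL-Analysis.Analysis"
begin

definition nonatomic_on :: "'a measure \<Rightarrow> 'a set \<Rightarrow> bool" where
  "nonatomic_on M S \<longleftrightarrow>
     (\<forall>B\<in>sets M. B \<subseteq> S \<and> 0 < emeasure M B \<longrightarrow>
        (\<exists>C\<in>sets M. C \<subseteq> B \<and> 0 < emeasure M C \<and> emeasure M C < emeasure M B))"

text \<open>space M = Ona \<union> A, Ona the non-atomic part, A the (countable) set of atoms,
  each atom a point of measure 1.  Three admissible types: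
  non-atomic (A empty, Ona of positive measure); counting measure on a countably
  infinite set (Ona empty, A infinite); mixed (Ona of positive measure, A nonempty).\<close>
definition admissible_space :: "'a measure \<Rightarrow> 'a set \<Rightarrow> 'a set \<Rightarrow> bool" where
  "admissible_space M Ona A \<longleftrightarrow>
     complete_measure M \<and> sigma_finite_measure M \<and>
     Ona \<in> sets M \<and> countable A \<and> Ona \<inter> A = {} \<and> space M = Ona \<union> A \<and>
     (\<forall>a\<in>A. {a} \<in> sets M \<and> emeasure M {a} = 1) \<and>
     nonatomic_on M Ona \<and>
     ((A = {} \<and> 0 < emeasure M Ona) \<or>
      (Ona = {} \<and> infinite A) \<or>
      (0 < emeasure M Ona \<and> A \<noteq> {}))"

definition orlicz_function :: "(real \<Rightarrow> real) \<Rightarrow> bool" where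
  "orlicz_function \<Phi> \<longleftrightarrow> convex_on UNIV \<Phi> \<and> (\<forall>u. \<Phi> (-u) = \<Phi> u) \<and>
     (\<forall>u. 0 \<le> \<Phi> u) \<and> \<Phi> 0 = 0 \<and> (\<exists>u. \<Phi> u \<noteq> 0)"

definition a_Phi :: "(real \<Rightarrow> real) \<Rightarrow> real" where
  "a_Phi \<Phi> = Sup {u. 0 \<le> u \<and> \<Phi> u = 0}"

definition delta2_Rplus :: "(real \<Rightarrow> real) \<Rightarrow> bool" where
  "delta2_Rplus \<Phi> \<longleftrightarrow> (\<exists>K>0. \<forall>u\<ge>0. \<Phi> (2*u) \<le> K * \<Phi> u)"

definition delta2_infty :: "(real \<Rightarrow> real) \<Rightarrow> bool" where
  "delta2_infty \<Phi> \<longleftrightarrow> (\<exists>u0>0. \<exists>K>0. \<forall>u\<ge>u0. \<Phi> (2*u) \<le> K * \<Phi> u)"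

definition delta2_zero :: "(real \<Rightarrow> real) \<Rightarrow> bool" where
  "delta2_zero \<Phi> \<longleftrightarrow> (\<exists>u0>0. \<exists>K>0. \<forall>u. 0 \<le> u \<and> u \<le> u0 \<longrightarrow> \<Phi> (2*u) \<le> K * \<Phi> u)"

definition suitable_delta2 :: "'a measure \<Rightarrow> 'a set \<Rightarrow> 'a set \<Rightarrow> (real \<Rightarrow> real) \<Rightarrow> bool" where
  "suitable_delta2 M Ona A \<Phi> \<longleftrightarrow>
     (0 < emeasure M Ona \<longrightarrow>
        (if emeasure M Ona = \<infinity> then delta2_Rplus \<Phi> else delta2_infty \<Phi>)) \<and>
     (infinite A \<longrightarrow> delta2_zero \<Phi>)"

definition lattice_norm_R2 :: "(real \<times> real \<Rightarrow> real) \<Rightarrow> bool" where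
  "lattice_norm_R2 p \<longleftrightarrow>
     (\<forall>X. 0 \<le> p X) \<and> (\<forall>X. p X = 0 \<longleftrightarrow> X = (0,0)) \<and>
     (\<forall>c u v. p (c * u, c * v) = abs c * p (u,v)) \<and>
     (\<forall>u v u' v'. p (u+u', v+v') \<le> p (u,v) + p (u',v')) \<and>
     (\<forall>u v u' v'. abs u \<le> abs u' \<and> abs v \<le> abs v' \<longrightarrow> p (u,v) \<le> p (u',v'))"

definition strictly_monotone_R2 :: "(real \<times> real \<Rightarrow> real) \<Rightarrow> bool" where
  "strictly_monotone_R2 p \<longleftrightarrow>
     (\<forall>u v u' v'. 0 \<le> u \<and> 0 \<le> v \<and> u \<le> u' \<and> v \<le> v' \<and> (u,v) \<noteq> (u',v')
        \<longrightarrow> p (u,v) < p (u',v'))"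

definition I_Phi :: "'a measure \<Rightarrow> (real \<Rightarrow> real) \<Rightarrow> ('a \<Rightarrow> real) \<Rightarrow> ennreal" where
  "I_Phi M \<Phi> x = (\<integral>\<^sup>+ t. ennreal (\<Phi> (x t)) \<partial>M)"

definition L_Phi :: "'a measure \<Rightarrow> (real \<Rightarrow> real) \<Rightarrow> ('a \<Rightarrow> real) set" where
  "L_Phi M \<Phi> = {x \<in> borel_measurable M. \<exists>lam>0. I_Phi M \<Phi> (\<lambda>t. lam * x t) < \<infinity>}"

definition E_Phi :: "'a measure \<Rightarrow> (real \<Rightarrow> real) \<Rightarrow> ('a \<Rightarrow> real) set" where
  "E_Phi M \<Phi> = {x \<in> borel_measurable M. \<forall>lam>0. I_Phi M \<Phi> (\<lambda>t. lam * x t) < \<infinity>}"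

text \<open>(1/k) p((1, I_Phi(kx))), with p((1,+\<infinity>)) = +\<infinity>.\<close>
definition amemiya_term :: "'a measure \<Rightarrow> (real \<Rightarrow> real) \<Rightarrow> (real \<times> real \<Rightarrow> real)
    \<Rightarrow> ('a \<Rightarrow> real) \<Rightarrow> real \<Rightarrow> ennreal" where
  "amemiya_term M \<Phi> p x k =
     (let I = I_Phi M \<Phi> (\<lambda>t. k * x t) in
      if I = \<infinity> then \<infinity> else ennreal (p (1, enn2real I) / k))"

definition orlicz_norm_ext :: "'a measure \<Rightarrow> (real \<Rightarrow> real) \<Rightarrow> (real \<times> real \<Rightarrow> real)
    \<Rightarrow> ('a \<Rightarrow> real) \<Rightarrow> ennreal" where
  "orlicz_norm_ext M \<Phi> p x = (INF k\<in>{0<..}. amemiya_term M \<Phi> p x k)"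

text \<open>Real-valued norm; it is finite (and meaningful) on L_Phi.\<close>
definition orlicz_norm :: "'a measure \<Rightarrow> (real \<Rightarrow> real) \<Rightarrow> (real \<times> real \<Rightarrow> real)
    \<Rightarrow> ('a \<Rightarrow> real) \<Rightarrow> real" where
  "orlicz_norm M \<Phi> p x = enn2real (orlicz_norm_ext M \<Phi> p x)"

definition K_set :: "'a measure \<Rightarrow> (real \<Rightarrow> real) \<Rightarrow> (real \<times> real \<Rightarrow> real)
    \<Rightarrow> ('a \<Rightarrow> real) \<Rightarrow> real set" where
  "K_set M \<Phi> p x = {k. 0 < k \<and> orlicz_norm_ext M \<Phi> p x = amemiya_term M \<Phi> p x k}"

definition uniformly_monotone :: "'a measure \<Rightarrow> ('a \<Rightarrow> real) set \<Rightarrow> (('a \<Rightarrow> real) \<Rightarrow> real) \<Rightarrow> bool" where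
  "uniformly_monotone M X N \<longleftrightarrow>
     (\<forall>\<epsilon>. 0 < \<epsilon> \<and> \<epsilon> < 1 \<longrightarrow> (\<exists>\<delta>. 0 < \<delta> \<and> \<delta> < 1 \<and>
        (\<forall>x\<in>X. \<forall>y\<in>X. (AE t in M. 0 \<le> x t \<and> x t \<le> y t) \<and> \<epsilon> \<le> N x \<and> N y = 1
            \<longrightarrow> N (\<lambda>t. y t - x t) \<le> 1 - \<delta>)))"

definition upper_locally_uniformly_monotone ::
    "'a measure \<Rightarrow> ('a \<Rightarrow> real) set \<Rightarrow> (('a \<Rightarrow> real) \<Rightarrow> real) \<Rightarrow> bool" where
  "upper_locally_uniformly_monotone M X N \<longleftrightarrow>
     (\<forall>y\<in>X. (AE t in M. 0 \<le> y t) \<and> N y = 1 \<longrightarrow>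
        (\<forall>\<epsilon>>0. \<exists>\<sigma>>0. \<forall>x\<in>X. (AE t in M. 0 \<le> x t) \<and> \<epsilon> \<le> N x
            \<longrightarrow> 1 + \<sigma> \<le> N (\<lambda>t. y t + x t)))"

end

theory Submission
  imports Defs
begin

text \<open>Sufficiency: take \<open>k\<close> almost optimal for \<open>y\<close>. Superadditivity of \<open>\<Phi>\<close> on the half-line gives
  \<open>I (k (y - x)) \<le> I (k y) - I (k x)\<close>. The growth condition keeps \<open>I (x / 2)\<close>, hence by convexity
  \<open>I (k x) / k\<close>, away from \<open>0\<close> for all admissible \<open>k\<close> at once, even if the optimal \<open>k\<close> is infinite.
  The points \<open>(1, I (k y)) / k\<close> lie in a fixed compact set, on which strict monotonicity
  of \<open>p\<close> is uniform.

  Necessity: let \<open>y\<close> be a normalised indicator function and \<open>k \<in> K(y)\<close>. If \<open>\<Phi>\<close> vanishes near \<open>0\<close> or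
  grows too fast, there are multiples \<open>x\<close> of indicator functions, disjoint from \<open>y\<close>, with norm bounded
  below but \<open>I (k x)\<close> arbitrarily small, so that the norm of \<open>y + x\<close> is arbitrarily close to \<open>1\<close>.\<close>

subsection \<open>Orlicz functions\<close>

lemma orlicz_convex: "orlicz_function \<Phi> \<Longrightarrow> convex_on UNIV \<Phi>"
  and orlicz_even: "orlicz_function \<Phi> \<Longrightarrow> \<Phi> (- u) = \<Phi> u"
  and orlicz_nonneg: "orlicz_function \<Phi> \<Longrightarrow> 0 \<le> \<Phi> u"
  and orlicz_zero: "orlicz_function \<Phi> \<Longrightarrow> \<Phi> 0 = 0"
  by (auto simp: orlicz_function_def)

lemma orlicz_abs: "orlicz_function \<Phi> \<Longrightarrow> \<Phi> \<bar>u\<bar> = \<Phi> u"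
  by (simp add: abs_if orlicz_even)

lemma orlicz_continuous: "orlicz_function \<Phi> \<Longrightarrow> continuous_on UNIV \<Phi>"
  using convex_on_continuous[OF open_UNIV] orlicz_convex by blast

lemma orlicz_measurable: "orlicz_function \<Phi> \<Longrightarrow> \<Phi> \<in> borel_measurable borel"
  by (rule borel_measurable_continuous_onI[OF orlicz_continuous])

lemma orlicz_scale_le:
  assumes "orlicz_function \<Phi>" "0 \<le> c" "c \<le> 1"
  shows "\<Phi> (c * u) \<le> c * \<Phi> u"
  using convex_onD[OF orlicz_convex[OF assms(1)] assms(2,3), of 0 u] orlicz_zero[OF assms(1)]
  by simp

text \<open>Division-free form of the monotonicity of \<open>\<Phi> (k * u) / k\<close> in
  \<open>k\<close>: convexity along the segment from \<open>0\<close> to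
  \<open>k * u\<close>.\<close>

lemma orlicz_slope_mono:
  assumes "orlicz_function \<Phi>" "0 < j" "j \<le> k"
  shows "k * \<Phi> (j * u) \<le> j * \<Phi> (k * u)"
  using orlicz_scale_le[OF assms(1), of "j / k" "k * u"] assms by (simp add: field_simps)

lemma orlicz_mono:
  assumes "orlicz_function \<Phi>" "\<bar>u\<bar> \<le> \<bar>v\<bar>"
  shows "\<Phi> u \<le> \<Phi> v"
proof (cases "v = 0")
  case False
  have "\<Phi> (\<bar>u\<bar> / \<bar>v\<bar> * \<bar>v\<bar>) \<le> \<bar>u\<bar> / \<bar>v\<bar> * \<Phi> \<bar>v\<bar>"
    using False assms by (intro orlicz_scale_le) auto
  also have "\<dots> \<le> 1 * \<Phi> \<bar>v\<bar>"
    using False assms orlicz_nonneg by (intro mult_right_mono) auto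
  finally show ?thesis
    using False assms by (simp add: orlicz_abs)
qed (use assms in auto)

text \<open>Both \<open>u\<close> and \<open>v\<close> are fractions of \<open>u + v\<close>; the
  two convexity bounds through the origin carry weights that add up to \<open>1\<close>.\<close>

lemma orlicz_superadd:
  assumes "orlicz_function \<Phi>" "0 \<le> u" "0 \<le> v"
  shows "\<Phi> u + \<Phi> v \<le> \<Phi> (u + v)"
proof (cases "u + v = 0")
  case True
  then have "u = 0" "v = 0"
    using assms by auto
  then show ?thesis
    using assms by (simp add: orlicz_zero)
next
  case False
  then have pos: "0 < u + v"
    using assms by auto
  have "\<Phi> (u / (u + v) * (u + v)) \<le> u / (u + v) * \<Phi> (u + v)"
       "\<Phi> (v / (u + v) * (u + v)) \<le> v / (u + v) * \<Phi> (u + v)"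
    using pos assms by (intro orlicz_scale_le; simp)+
  then have "\<Phi> u + \<Phi> v \<le> (u / (u + v) + v / (u + v)) * \<Phi> (u + v)"
    using pos by (simp add: distrib_right)
  also have "u / (u + v) + v / (u + v) = 1"
    using pos by (simp add: add_divide_distrib[symmetric])
  finally show ?thesis by simp
qed

lemma orlicz_unbounded:
  assumes "orlicz_function \<Phi>"
  shows "\<exists>u>0. B \<le> \<Phi> u"
proof -
  obtain w where "\<Phi> w \<noteq> 0"
    using assms by (auto simp: orlicz_function_def)
  then have w: "0 < \<Phi> \<bar>w\<bar>" "0 < \<bar>w\<bar>"
    using assms orlicz_nonneg[OF assms, of w] orlicz_zero[OF assms]
    by (auto simp: orlicz_abs less_le)
  \<comment> \<open>Past a point where \<Phi> is positive, growth is at least linear; the maximum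
    with \<open>1\<close> makes the slope comparison with \<open>w\<close> applicable.\<close>
  define k where "k = max 1 (B / \<Phi> \<bar>w\<bar>)"
  have "k * \<Phi> (1 * \<bar>w\<bar>) \<le> 1 * \<Phi> (k * \<bar>w\<bar>)"
    by (rule orlicz_slope_mono[OF assms]) (auto simp: k_def)
  moreover have "B / \<Phi> \<bar>w\<bar> * \<Phi> \<bar>w\<bar> \<le> k * \<Phi> \<bar>w\<bar>"
    using w by (intro mult_right_mono) (auto simp: k_def)
  ultimately have "B \<le> \<Phi> (k * \<bar>w\<bar>)"
    using w by simp
  moreover have "0 < k * \<bar>w\<bar>"
    using w by (auto simp: k_def)
  ultimately show ?thesis by blast
qed

lemma a_Phi_eq_0_iff:
  assumes "orlicz_function \<Phi>"
  shows "a_Phi \<Phi> = 0 \<longleftrightarrow> (\<forall>u>0. 0 < \<Phi> u)"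
proof
  obtain w where w: "0 < w" "1 \<le> \<Phi> w"
    using orlicz_unbounded[OF assms, of 1] by auto
  \<comment> \<open>The supremum bounds the zeros of \<Phi> only once their set is known to be
    bounded; monotonicity excludes zeros beyond \<open>w\<close>.\<close>
  have bdd: "bdd_above {u. 0 \<le> u \<and> \<Phi> u = 0}"
  proof (rule bdd_aboveI)
    fix u assume u: "u \<in> {u. 0 \<le> u \<and> \<Phi> u = 0}"
    show "u \<le> w"
    proof (rule ccontr)
      assume "\<not> u \<le> w"
      then have "\<Phi> w \<le> \<Phi> u"
        using w by (intro orlicz_mono[OF assms]) auto
      then show False using u w by auto
    qed
  qed
  assume a: "a_Phi \<Phi> = 0"
  show "\<forall>u>0. 0 < \<Phi> u"
  proof (intro allI impI, rule ccontr)
    fix u :: real assume u: "0 < u" "\<not> 0 < \<Phi> u"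
    then have "u \<in> {u. 0 \<le> u \<and> \<Phi> u = 0}"
      using orlicz_nonneg[OF assms, of u] by auto
    then have "u \<le> a_Phi \<Phi>"
      unfolding a_Phi_def using bdd by (rule cSup_upper)
    then show False using a u by simp
  qed
next
  assume "\<forall>u>0. 0 < \<Phi> u"
  then have "{u. 0 \<le> u \<and> \<Phi> u = 0} = {0}"
    using orlicz_zero[OF assms] by (auto simp: less_le)
  then show "a_Phi \<Phi> = 0" by (simp add: a_Phi_def)
qed

section \<open>Iterating and extending the doubling condition\<close>

lemma delta2_iterate_above:
  fixes \<Phi> :: "real \<Rightarrow> real"
  assumes "\<And>u. d \<le> u \<Longrightarrow> \<Phi> (2 * u) \<le> K * \<Phi> u" "0 < K" "0 \<le> d" "d \<le> u"
  shows "\<Phi> (2 ^ m * u) \<le> K ^ m * \<Phi> u"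
proof (induction m)
  case (Suc m)
  have "1 * u \<le> 2 ^ m * u"
    using assms by (intro mult_right_mono) auto
  then have "\<Phi> (2 * (2 ^ m * u)) \<le> K * \<Phi> (2 ^ m * u)"
    using assms by (intro assms(1)) auto
  also have "\<dots> \<le> K * (K ^ m * \<Phi> u)"
    using Suc assms by (intro mult_left_mono) auto
  finally show ?case by (simp add: mult.assoc)
qed simp

lemma delta2_iterate_below:
  fixes \<Phi> :: "real \<Rightarrow> real"
  assumes "\<And>u. 0 \<le> u \<Longrightarrow> u \<le> u0 \<Longrightarrow> \<Phi> (2 * u) \<le> K * \<Phi> u" "0 < K" "0 \<le> u" "2 ^ m * u \<le> u0"
  shows "\<Phi> (2 ^ m * u) \<le> K ^ m * \<Phi> u"
  using assms(4)
proof (induction m)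
  case (Suc m)
  have le: "2 ^ m * u \<le> 2 ^ Suc m * u"
    using assms by (intro mult_right_mono) auto
  then have small: "2 ^ m * u \<le> u0"
    using Suc.prems by linarith
  then have "\<Phi> (2 * (2 ^ m * u)) \<le> K * \<Phi> (2 ^ m * u)"
    using assms(3) by (intro assms(1)) auto
  also have "\<dots> \<le> K * (K ^ m * \<Phi> u)"
    using Suc.IH[OF small] assms(2) by (intro mult_left_mono) auto
  finally show ?case by (simp add: mult.assoc)
qed simp

text \<open>Where \<Phi> is positive, the threshold can be lowered to any \<open>d > 0\<close>: for
  \<open>u\<close> between \<open>d\<close> and \<open>u0\<close> the quotient
  \<open>\<Phi> (2 * u) / \<Phi> u\<close> is at most
  \<open>\<Phi> (2 * u0) / \<Phi> d\<close>.\<close>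

lemma delta2_infty_extend:
  assumes \<Phi>: "orlicz_function \<Phi>" and "delta2_infty \<Phi>" and pos: "\<And>u. 0 < u \<Longrightarrow> 0 < \<Phi> u" and "0 < d"
  obtains K where "0 < K" "\<And>u. d \<le> u \<Longrightarrow> \<Phi> (2 * u) \<le> K * \<Phi> u"
proof -
  obtain u0 K where K: "0 < u0" "0 < K" "\<And>u. u0 \<le> u \<Longrightarrow> \<Phi> (2 * u) \<le> K * \<Phi> u"
    using assms(2) by (auto simp: delta2_infty_def)
  define K' where "K' = max K (\<Phi> (2 * u0) / \<Phi> d)"
  have "\<Phi> (2 * u) \<le> K' * \<Phi> u" if "d \<le> u" for u
  proof (cases "u0 \<le> u")
    case True
    have "K * \<Phi> u \<le> K' * \<Phi> u"
      by (intro mult_right_mono) (auto simp: K'_def orlicz_nonneg[OF \<Phi>])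
    with K(3)[OF True] show ?thesis by linarith
  next
    case False
    then have "\<Phi> (2 * u) \<le> \<Phi> (2 * u0)"
      using that \<open>0 < d\<close> by (intro orlicz_mono[OF \<Phi>]) auto
    also have "\<dots> = \<Phi> (2 * u0) / \<Phi> d * \<Phi> d"
      using pos[OF \<open>0 < d\<close>] by simp
    also have "\<dots> \<le> K' * \<Phi> u"
      using that \<open>0 < d\<close> orlicz_nonneg[OF \<Phi>] K
      by (intro mult_mono orlicz_mono[OF \<Phi>]) (auto simp: K'_def max_def)
    finally show ?thesis .
  qed
  moreover have "0 < K'"
    using K by (auto simp: K'_def)
  ultimately show ?thesis using that by blast
qed

subsection \<open>Subsets of prescribed size\<close>

text \<open>Repeated halving: when a set is split into two parts of positive measure, the smaller
  part has at most half the measure.\<close>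

lemma nonatomic_subset_less:
  assumes na: "nonatomic_on M S" and C: "C \<in> sets M" "C \<subseteq> S" "0 < emeasure M C" "emeasure M C < \<infinity>"
    and s: "0 < (s::real)"
  shows "\<exists>B\<in>sets M. B \<subseteq> C \<and> 0 < emeasure M B \<and> emeasure M B < ennreal s"
proof -
  have half: "\<exists>B\<in>sets M. B \<subseteq> C \<and> 0 < emeasure M B \<and> 2 ^ n * emeasure M B \<le> emeasure M C" for n :: nat
  proof (induction n)
    case 0
    then show ?case using C by auto
  next
    case (Suc n)
    then obtain B where B: "B \<in> sets M" "B \<subseteq> C" "0 < emeasure M B" "2 ^ n * emeasure M B \<le> emeasure M C"
      by blast
    then obtain D where D: "D \<in> sets M" "D \<subseteq> B" "0 < emeasure M D" "emeasure M D < emeasure M B"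
      using na C unfolding nonatomic_on_def by (meson order_trans)
    have split: "emeasure M D + emeasure M (B - D) = emeasure M B"
      using plus_emeasure[of D M "B - D"] B D by (simp add: Un_absorb1)
    have pos: "0 < emeasure M (B - D)"
      using split D by (cases "emeasure M (B - D) = 0") (auto simp: zero_less_iff_neq_zero)
    have "\<exists>E\<in>sets M. E \<subseteq> B \<and> 0 < emeasure M E \<and> 2 * emeasure M E \<le> emeasure M B"
    proof (cases "emeasure M D \<le> emeasure M (B - D)")
      case True
      then have "2 * emeasure M D \<le> emeasure M B"
        using split by (metis add_left_mono mult_2)
      with D show ?thesis by blast
    next
      case False
      then have "2 * emeasure M (B - D) \<le> emeasure M B"
        using split by (metis add_right_mono mult_2 nle_le)
      with pos B D show ?thesis by blast
    qed
    then obtain E where E: "E \<in> sets M" "E \<subseteq> B" "0 < emeasure M E" "2 * emeasure M E \<le> emeasure M B"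
      by blast
    have "2 ^ Suc n * emeasure M E = 2 ^ n * (2 * emeasure M E)"
      by (simp add: ac_simps)
    also have "\<dots> \<le> 2 ^ n * emeasure M B"
      using E by (intro mult_left_mono) auto
    also have "\<dots> \<le> emeasure M C" by fact
    finally show ?case using E B by blast
  qed
  obtain c where c: "emeasure M C = ennreal c" "0 < c"
    using C by (cases "emeasure M C") auto
  obtain n :: nat where n: "c / s < 2 ^ n"
    using real_arch_pow[of 2 "c / s"] by auto
  obtain B where B: "B \<in> sets M" "B \<subseteq> C" "0 < emeasure M B" "2 ^ n * emeasure M B \<le> emeasure M C"
    using half by blast
  have "emeasure M B \<le> emeasure M C"
    using B C by (intro emeasure_mono) auto
  then obtain b where b: "emeasure M B = ennreal b" "0 \<le> b"
    using c by (cases "emeasure M B") (auto simp: top_unique)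
  have "ennreal (2 ^ n * b) \<le> ennreal c"
    using B(4) b c by (simp add: ennreal_mult ennreal_power[symmetric] flip: ennreal_numeral)
  then have "2 ^ n * b \<le> c" using c by simp
  also have "c < 2 ^ n * s"
    using n s by (simp add: field_simps)
  finally have "b < s" by simp
  then show ?thesis using B b s by (auto simp: ennreal_less_iff)
qed

text \<open>If the interval were avoided, the subsets of measure below \<open>s\<close> would be closed under unions;
  a union of maximal measure could then be enlarged by a small set.\<close>

lemma nonatomic_subset_between:
  assumes na: "nonatomic_on M S" and C: "C \<in> sets M" "C \<subseteq> S" "emeasure M C < \<infinity>"
    and s: "0 < (s::real)" "ennreal s \<le> emeasure M C"
  shows "\<exists>B\<in>sets M. B \<subseteq> C \<and> ennreal s \<le> emeasure M B \<and> emeasure M B \<le> ennreal (2 * s)"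
proof (rule ccontr)
  assume "\<not> ?thesis"
  then have gap: "ennreal (2 * s) < emeasure M B" if "B \<in> sets M" "B \<subseteq> C" "ennreal s \<le> emeasure M B" for B
    using that by (meson not_le)
  define F where "F = {B \<in> sets M. B \<subseteq> C \<and> emeasure M B < ennreal s}"
  have ne: "{} \<in> F" using s by (auto simp: F_def)
  \<comment> \<open>The union has measure at most \<open>2 * s\<close>, and by the assumed gap this
    already forces it below \<open>s\<close>.\<close>
  have Un: "X \<union> Y \<in> F" if "X \<in> F" "Y \<in> F" for X Y
  proof -
    have "emeasure M (X \<union> Y) \<le> emeasure M X + emeasure M Y"
      using that by (intro emeasure_subadditive) (auto simp: F_def)
    also have "\<dots> \<le> ennreal s + ennreal s"
      using that by (intro add_mono) (auto simp: F_def)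
    also have "\<dots> = ennreal (2 * s)"
      using s by (simp flip: ennreal_plus)
    finally show ?thesis
      using gap[of "X \<union> Y"] that by (force simp: F_def)
  qed
  \<comment> \<open>The finite unions of a maximising sequence increase within \<open>F\<close>;
    their limit \<open>U\<close> attains the supremum and, by the gap again, stays in
    \<open>F\<close>.\<close>
  obtain f :: "nat \<Rightarrow> ennreal" where f: "range f \<subseteq> emeasure M ` F" "Sup (emeasure M ` F) = (SUP n. f n)"
    using ennreal_Sup_countable_SUP[of "emeasure M ` F"] ne by blast
  then have "\<forall>n. \<exists>B\<in>F. f n = emeasure M B" by blast
  then obtain G where G: "\<And>n::nat. G n \<in> F" "\<And>n. f n = emeasure M (G n)" by metis
  define H where "H n = (\<Union>i\<le>n. G i)" for n
  have HF: "H n \<in> F" for n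
  proof (induction n)
    case 0 then show ?case using G by (simp add: H_def)
  next
    case (Suc n)
    have "H (Suc n) = H n \<union> G (Suc n)" by (auto simp: H_def atMost_Suc)
    then show ?case using Suc G Un by simp
  qed
  define U where "U = (\<Union>n. H n)"
  have U: "U \<in> sets M" "U \<subseteq> C"
    using HF by (auto simp: U_def F_def)
  have SUP: "emeasure M U = (SUP n. emeasure M (H n))"
    unfolding U_def using HF
    by (intro SUP_emeasure_incseq[symmetric]) (force simp: F_def H_def incseq_def)+
  have "emeasure M U \<le> ennreal s"
    unfolding SUP using HF by (intro SUP_least) (auto simp: F_def less_imp_le)
  also have "ennreal s \<le> ennreal (2 * s)" using s by simp
  finally have UF: "U \<in> F"
    using gap[of U] U by (force simp: F_def)
  have max: "emeasure M B \<le> emeasure M U" if "B \<in> F" for B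
  proof -
    have "emeasure M B \<le> Sup (emeasure M ` F)" using that by (intro Sup_upper) auto
    also have "\<dots> \<le> emeasure M U"
      unfolding f(2) using G U
      by (intro SUP_least) (auto intro!: emeasure_mono simp: U_def H_def)
    finally show ?thesis .
  qed
  have "emeasure M C \<noteq> emeasure M U"
    using UF s by (auto simp: F_def)
  moreover have "emeasure M U + emeasure M (C - U) = emeasure M C"
    using plus_emeasure[of U M "C - U"] U C by (simp add: Un_absorb1)
  ultimately have pos: "0 < emeasure M (C - U)"
    by (metis add.right_neutral zero_less_iff_neq_zero)
  have "emeasure M (C - U) \<le> emeasure M C"
    using C by (intro emeasure_mono) auto
  then have fin: "emeasure M (C - U) < \<infinity>" using C by (metis order_le_less_trans)
  obtain B where B: "B \<in> sets M" "B \<subseteq> C - U" "0 < emeasure M B" "emeasure M B < ennreal s"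
    using nonatomic_subset_less[OF na _ _ pos fin s(1)] U C by blast
  have "emeasure M (U \<union> B) = emeasure M U + emeasure M B"
    using U B by (intro plus_emeasure[symmetric]) auto
  moreover have "U \<union> B \<in> F"
    using UF B by (intro Un) (auto simp: F_def)
  ultimately have "emeasure M U + emeasure M B \<le> emeasure M U + 0"
    using max by (metis add.right_neutral)
  moreover have "emeasure M U \<noteq> \<infinity>" using UF by (auto simp: F_def)
  ultimately show False
    using B by (simp add: ennreal_add_left_cancel_le)
qed

text \<open>Intersect \<open>C\<close> with an increasing exhaustion by sets of finite measure and
  use continuity from below.\<close>

lemma sigma_finite_subset_finite_ge:
  assumes sf: "sigma_finite_measure M" and C: "C \<in> sets M" and r: "r < emeasure M C"
  shows "\<exists>B\<in>sets M. B \<subseteq> C \<and> r < emeasure M B \<and> emeasure M B < \<infinity>"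
proof -
  obtain R :: "nat \<Rightarrow> 'a set" where R: "range R \<subseteq> sets M" "(\<Union>i. R i) = space M"
      "\<And>i. emeasure M (R i) \<noteq> \<infinity>" "incseq R"
    using sigma_finite_measure.sigma_finite_incseq[OF sf] by blast
  have "(SUP i. emeasure M (C \<inter> R i)) = emeasure M (\<Union>i. C \<inter> R i)"
    using R C by (intro SUP_emeasure_incseq) (auto simp: incseq_def, blast)
  also have "(\<Union>i. C \<inter> R i) = C"
    unfolding Int_UN_distrib[symmetric] R(2) using C by simp
  finally obtain i where i: "r < emeasure M (C \<inter> R i)"
    using r by (metis less_SUP_iff)
  have "emeasure M (C \<inter> R i) \<le> emeasure M (R i)"
    using R by (intro emeasure_mono) auto
  then have "emeasure M (C \<inter> R i) < \<infinity>"
    using R(3)[of i] by (metis infinity_ennreal_def order_le_less_trans top.not_eq_extremum)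
  then show ?thesis using i R C by (intro bexI[of _ "C \<inter> R i"]) auto
qed

subsection \<open>The modular and the norm\<close>

locale orlicz_amemiya =
  fixes M :: "'a measure" and \<Phi> :: "real \<Rightarrow> real" and p :: "real \<times> real \<Rightarrow> real"
  assumes p_norm: "lattice_norm_R2 p" and p_e1: "p (1, 0) = 1" and p_e2: "p (0, 1) = 1"
    and \<Phi>: "orlicz_function \<Phi>"
begin

abbreviation I where "I \<equiv> I_Phi M \<Phi>"
abbreviation ext where "ext \<equiv> orlicz_norm_ext M \<Phi> p"
abbreviation N where "N \<equiv> orlicz_norm M \<Phi> p"

section \<open>The norm on the plane\<close>

lemma p_nonneg: "0 \<le> p X"
  using p_norm unfolding lattice_norm_R2_def by blast

lemma p_scale: "0 \<le> c \<Longrightarrow> p (c * u, c * v) = c * p (u, v)"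
  using p_norm by (auto simp: lattice_norm_R2_def)

lemma p_divide: "0 < k \<Longrightarrow> p (u, v) / k = p (u / k, v / k)"
  using p_scale[of "1 / k" u v] by simp

lemma p_triangle: "p (u + u', v + v') \<le> p (u, v) + p (u', v')"
  using p_norm by (auto simp: lattice_norm_R2_def)

lemma p_mono: "0 \<le> u \<Longrightarrow> u \<le> u' \<Longrightarrow> 0 \<le> v \<Longrightarrow> v \<le> v' \<Longrightarrow> p (u, v) \<le> p (u', v')"
  using p_norm unfolding lattice_norm_R2_def by (metis abs_of_nonneg order_trans)

text \<open>Together with \<open>p_ge_snd\<close> this bounds both \<open>1 / k\<close> and
  \<open>I (k x) / k\<close> by the Amemiya quotient at \<open>k\<close>.\<close>

lemma p_ge_fst: "0 \<le> b \<Longrightarrow> 1 \<le> p (1, b)"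
  using p_mono[of 1 1 0 b] p_e1 by simp

lemma p_ge_snd: "0 \<le> b \<Longrightarrow> b \<le> p (1, b)"
  using p_mono[of 0 1 b b] p_scale[of b 0 1] p_e2 by simp

lemma p_le_sum: "0 \<le> b \<Longrightarrow> p (1, b) \<le> 1 + b"
  using p_triangle[of 1 0 0 b] p_scale[of b 0 1] p_e1 p_e2 by simp

text \<open>A norm is convex, and convex functions on a finite-dimensional space are
  continuous.\<close>

lemma p_continuous: "continuous_on UNIV p"
proof (rule convex_on_continuous[OF open_UNIV])
  show "convex_on UNIV p"
  proof (rule convex_onI)
    fix t :: real and X Y :: "real \<times> real"
    assume t: "0 < t" "t < 1"
    obtain a b c d where XY: "X = (a, b)" "Y = (c, d)" by fastforce
    have "p ((1 - t) * a + t * c, (1 - t) * b + t * d) \<le> p ((1 - t) * a, (1 - t) * b) + p (t * c, t * d)"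
      by (rule p_triangle)
    then show "p ((1 - t) *\<^sub>R X + t *\<^sub>R Y) \<le> (1 - t) * p X + t * p Y"
      using t by (simp add: XY p_scale)
  qed auto
qed

text \<open>The drop of \<open>p\<close> when the second coordinate decreases by \<open>c0\<close>
  is continuous and strictly positive, so it has a positive minimum on a compact rectangle; a larger
  decrease \<open>c\<close> only enlarges it. The bound \<open>2\<close> is what a nearly optimal
  \<open>k\<close> yields for an element of norm \<open>1\<close>.\<close>

lemma p_uniform_gap:
  assumes strict: "strictly_monotone_R2 p" and c0: "0 < c0"
  obtains \<delta> where "0 < \<delta>"
    "\<And>a b c. 0 \<le> a \<Longrightarrow> a \<le> 2 \<Longrightarrow> c0 \<le> c \<Longrightarrow> c \<le> b \<Longrightarrow> b \<le> 2 \<Longrightarrow> p (a, b - c) + \<delta> \<le> p (a, b)"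
proof (cases "c0 \<le> 2")
  case True
  define f where "f = (\<lambda>(a, b). p (a, b) - p (a, b - c0))"
  have "continuous_on ({0..2} \<times> {c0..2}) f"
    unfolding f_def case_prod_unfold
    by (intro continuous_intros continuous_on_compose2[OF p_continuous]) auto
  moreover have "compact ({0..2::real} \<times> {c0..2})" "{0..2::real} \<times> {c0..2} \<noteq> {}"
    using True by (auto intro!: compact_Times)
  ultimately obtain X where X: "X \<in> {0..2} \<times> {c0..2}" "\<And>Y. Y \<in> {0..2} \<times> {c0..2} \<Longrightarrow> f X \<le> f Y"
    using continuous_attains_inf by metis
  have "0 < f X"
    using X(1) strict c0 by (force simp: f_def strictly_monotone_R2_def)
  moreover have "p (a, b - c) + f X \<le> p (a, b)"
    if "0 \<le> a" "a \<le> 2" "c0 \<le> c" "c \<le> b" "b \<le> 2" for a b c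
  proof -
    have "p (a, b - c) \<le> p (a, b - c0)" using that by (intro p_mono) auto
    moreover have "f X \<le> f (a, b)" using that by (intro X) auto
    ultimately show ?thesis by (simp add: f_def)
  qed
  ultimately show ?thesis using that by blast
next
  case False
  \<comment> \<open>No \<open>c\<close> lies between \<open>c0\<close> and \<open>2\<close>, so the
    claim is vacuous and any gap will do.\<close>
  then show ?thesis by (intro that[of 1]) auto
qed

section \<open>The modular, and the spaces it defines\<close>

lemma modular_measurable [measurable]:
  "x \<in> borel_measurable M \<Longrightarrow> (\<lambda>t. \<Phi> (x t)) \<in> borel_measurable M"
  using orlicz_measurable[OF \<Phi>] by measurable

lemma I_mono:
  assumes "AE t in M. \<bar>x t\<bar> \<le> \<bar>y t\<bar>"
  shows "I x \<le> I y"
  unfolding I_Phi_def using assms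
  by (intro nn_integral_mono_AE) (auto intro!: ennreal_leI orlicz_mono[OF \<Phi>])

lemma I_diff_add_le:
  assumes [measurable]: "x \<in> borel_measurable M" "y \<in> borel_measurable M"
    and le: "AE t in M. 0 \<le> x t \<and> x t \<le> y t"
  shows "I (\<lambda>t. y t - x t) + I x \<le> I y"
proof -
  have "I (\<lambda>t. y t - x t) + I x = (\<integral>\<^sup>+t. ennreal (\<Phi> (y t - x t)) + ennreal (\<Phi> (x t)) \<partial>M)"
    unfolding I_Phi_def by (intro nn_integral_add[symmetric]) measurable
  also have "\<dots> \<le> I y"
    unfolding I_Phi_def
  proof (rule nn_integral_mono_AE, use le in eventually_elim)
    fix t assume "0 \<le> x t \<and> x t \<le> y t"
    then show "ennreal (\<Phi> (y t - x t)) + ennreal (\<Phi> (x t)) \<le> ennreal (\<Phi> (y t))"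
      using orlicz_superadd[OF \<Phi>, of "y t - x t" "x t"]
      by (simp add: orlicz_nonneg[OF \<Phi>] flip: ennreal_plus)
  qed
  finally show ?thesis .
qed

lemma I_slope_mono:
  assumes [measurable]: "x \<in> borel_measurable M" and jk: "0 < j" "j \<le> k"
  shows "ennreal k * I (\<lambda>t. j * x t) \<le> ennreal j * I (\<lambda>t. k * x t)"
proof -
  have "ennreal k * I (\<lambda>t. j * x t) = (\<integral>\<^sup>+t. ennreal k * ennreal (\<Phi> (j * x t)) \<partial>M)"
    unfolding I_Phi_def by (intro nn_integral_cmult[symmetric]) measurable
  also have "\<dots> \<le> (\<integral>\<^sup>+t. ennreal j * ennreal (\<Phi> (k * x t)) \<partial>M)"
    using orlicz_slope_mono[OF \<Phi> jk] jk
    by (intro nn_integral_mono) (simp add: orlicz_nonneg[OF \<Phi>] flip: ennreal_mult)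
  also have "\<dots> = ennreal j * I (\<lambda>t. k * x t)"
    unfolding I_Phi_def by (intro nn_integral_cmult) measurable
  finally show ?thesis .
qed

lemma I_indicator:
  assumes "B \<in> sets M"
  shows "I (\<lambda>t. c * indicator B t) = ennreal (\<Phi> c) * emeasure M B"
proof -
  have "I (\<lambda>t. c * indicator B t) = (\<integral>\<^sup>+t. ennreal (\<Phi> c) * indicator B t \<partial>M)"
    unfolding I_Phi_def
    by (intro nn_integral_cong) (auto simp: indicator_def orlicz_zero[OF \<Phi>])
  then show ?thesis using assms by (simp add: nn_integral_cmult_indicator)
qed

lemma I_indicator_add:
  assumes "B \<in> sets M" "D \<in> sets M" "B \<inter> D = {}"
  shows "I (\<lambda>t. c * indicator B t + d * indicator D t)
    = I (\<lambda>t. c * indicator B t) + I (\<lambda>t. d * indicator D t)"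
proof -
  have [measurable]: "B \<in> sets M" "D \<in> sets M" using assms by auto
  have "I (\<lambda>t. c * indicator B t + d * indicator D t)
    = (\<integral>\<^sup>+t. ennreal (\<Phi> (c * indicator B t)) + ennreal (\<Phi> (d * indicator D t)) \<partial>M)"
    unfolding I_Phi_def using assms
    by (intro nn_integral_cong) (auto simp: indicator_def orlicz_zero[OF \<Phi>])
  also have "\<dots> = I (\<lambda>t. c * indicator B t) + I (\<lambda>t. d * indicator D t)"
    unfolding I_Phi_def by (intro nn_integral_add) measurable
  finally show ?thesis .
qed

lemma indicator_in_E:
  assumes "B \<in> sets M" "emeasure M B < \<infinity>"
  shows "(\<lambda>t. c * indicator B t) \<in> E_Phi M \<Phi>"
  using assms I_indicator[of B "lam * c" for lam]
  by (auto simp: E_Phi_def mult.assoc[symmetric] ennreal_mult_less_top)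

lemma L_scale:
  assumes "x \<in> L_Phi M \<Phi>" "0 < c"
  shows "(\<lambda>t. c * x t) \<in> L_Phi M \<Phi>"
proof -
  obtain lam where lam: "0 < lam" "I (\<lambda>t. lam * x t) < \<infinity>" and [measurable]: "x \<in> borel_measurable M"
    using assms by (auto simp: L_Phi_def)
  have "I (\<lambda>t. lam / c * (c * x t)) < \<infinity>"
    using lam assms by simp
  moreover have "0 < lam / c" using lam assms by simp
  ultimately show ?thesis unfolding L_Phi_def by auto
qed

text \<open>Convexity would even give a factor \<open>1 / 2\<close>; the cruder bound suffices for
  the finiteness needed in \<open>L_add\<close>.\<close>

lemma I_midpoint:
  assumes [measurable]: "x \<in> borel_measurable M" "y \<in> borel_measurable M"
  shows "I (\<lambda>t. (x t + y t) / 2) \<le> I x + I y"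
proof -
  have "I (\<lambda>t. (x t + y t) / 2) \<le> (\<integral>\<^sup>+t. ennreal (\<Phi> (x t)) + ennreal (\<Phi> (y t)) \<partial>M)"
    unfolding I_Phi_def
  proof (rule nn_integral_mono)
    fix t
    have "\<Phi> ((1 - 1/2) *\<^sub>R x t + (1/2) *\<^sub>R y t) \<le> (1 - 1/2) * \<Phi> (x t) + (1/2) * \<Phi> (y t)"
      by (intro convex_onD[OF orlicz_convex[OF \<Phi>]]) auto
    also have "\<dots> \<le> \<Phi> (x t) + \<Phi> (y t)"
      using orlicz_nonneg[OF \<Phi>, of "x t"] orlicz_nonneg[OF \<Phi>, of "y t"] by simp
    finally show "ennreal (\<Phi> ((x t + y t) / 2)) \<le> ennreal (\<Phi> (x t)) + ennreal (\<Phi> (y t))"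
      by (simp add: orlicz_nonneg[OF \<Phi>] add_divide_distrib flip: ennreal_plus)
  qed
  also have "\<dots> = I x + I y"
    unfolding I_Phi_def by (intro nn_integral_add) measurable
  finally show ?thesis .
qed

lemma L_add:
  assumes "x \<in> L_Phi M \<Phi>" "y \<in> L_Phi M \<Phi>"
  shows "(\<lambda>t. x t + y t) \<in> L_Phi M \<Phi>"
proof -
  obtain a b where ab: "0 < a" "I (\<lambda>t. a * x t) < \<infinity>" "0 < b" "I (\<lambda>t. b * y t) < \<infinity>"
    and [measurable]: "x \<in> borel_measurable M" "y \<in> borel_measurable M"
    using assms by (auto simp: L_Phi_def)
  define m where "m = min a b"
  have m: "0 < m" "m \<le> a" "m \<le> b" using ab by (auto simp: m_def)
  have "I (\<lambda>t. m * x t) \<le> I (\<lambda>t. a * x t)" "I (\<lambda>t. m * y t) \<le> I (\<lambda>t. b * y t)"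
    using m by (intro I_mono; auto simp: abs_mult intro!: mult_right_mono)+
  moreover have "I (\<lambda>t. (m * x t + m * y t) / 2) \<le> I (\<lambda>t. m * x t) + I (\<lambda>t. m * y t)"
    by (intro I_midpoint) measurable
  moreover have "(\<lambda>t. m / 2 * (x t + y t)) = (\<lambda>t. (m * x t + m * y t) / 2)"
    by (simp add: distrib_left add_divide_distrib)
  ultimately have "I (\<lambda>t. m / 2 * (x t + y t)) \<le> I (\<lambda>t. a * x t) + I (\<lambda>t. b * y t)"
    by (simp only:) (rule order_trans, assumption, rule add_mono)
  also have "\<dots> < \<infinity>" using ab by simp
  finally show ?thesis
    unfolding L_Phi_def using m by (auto intro!: exI[of _ "m / 2"])
qed

section \<open>The Amemiya norm as an infimum\<close>

lemma ext_le:
  assumes "0 < k" "0 \<le> B" "I (\<lambda>t. k * x t) \<le> ennreal B"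
  shows "ext x \<le> ennreal (p (1, B) / k)"
proof -
  have fin: "I (\<lambda>t. k * x t) \<noteq> \<infinity>"
    using assms(3) by (auto simp: top_unique)
  have "enn2real (I (\<lambda>t. k * x t)) \<le> B"
    using assms by (metis enn2real_mono enn2real_ennreal ennreal_less_top)
  then have "p (1, enn2real (I (\<lambda>t. k * x t))) \<le> p (1, B)"
    by (intro p_mono) auto
  then have "amemiya_term M \<Phi> p x k \<le> ennreal (p (1, B) / k)"
    using fin assms by (auto simp: amemiya_term_def Let_def intro!: ennreal_leI divide_right_mono)
  moreover have "ext x \<le> amemiya_term M \<Phi> p x k"
    unfolding orlicz_norm_ext_def using assms by (intro INF_lower) auto
  ultimately show ?thesis by (rule order_trans[rotated])
qed

text \<open>A scale \<open>k\<close> with infinite modular contributes infinity to the infimum, so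
  only scales with a real modular have to be tested.\<close>

lemma ext_ge:
  assumes "\<And>k B. 0 < k \<Longrightarrow> 0 \<le> B \<Longrightarrow> I (\<lambda>t. k * x t) = ennreal B \<Longrightarrow> c \<le> ennreal (p (1, B) / k)"
  shows "c \<le> ext x"
  unfolding orlicz_norm_ext_def
proof (rule INF_greatest)
  fix k :: real assume "k \<in> {0<..}"
  then show "c \<le> amemiya_term M \<Phi> p x k"
    using assms[of k] by (cases "I (\<lambda>t. k * x t)") (auto simp: amemiya_term_def Let_def)
qed

text \<open>Supplies a nearly optimal scale where the infimum need not be attained.\<close>

lemma ext_approx:
  assumes "ext x < c"
  obtains k B where "0 < k" "0 \<le> B" "I (\<lambda>t. k * x t) = ennreal B" "ennreal (p (1, B) / k) < c"
  using ext_ge[of x c] assms that by (meson not_le)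

lemma ext_mono:
  assumes "AE t in M. \<bar>x t\<bar> \<le> \<bar>y t\<bar>"
  shows "ext x \<le> ext y"
proof (rule ext_ge)
  fix k B assume kB: "0 < k" "0 \<le> B" "I (\<lambda>t. k * y t) = ennreal B"
  have "I (\<lambda>t. k * x t) \<le> I (\<lambda>t. k * y t)"
    using assms kB by (intro I_mono) (auto simp: abs_mult)
  then show "ext x \<le> ennreal (p (1, B) / k)"
    using kB by (intro ext_le) auto
qed

lemma ext_scale_ge:
  assumes "0 < c"
  shows "ennreal c * ext x \<le> ext (\<lambda>t. c * x t)"
proof (rule ext_ge)
  fix k B assume kB: "0 < k" "0 \<le> B" "I (\<lambda>t. k * (c * x t)) = ennreal B"
  then have "ext x \<le> ennreal (p (1, B) / (k * c))"
    using assms by (intro ext_le) (auto simp: mult.assoc)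
  then have "ennreal c * ext x \<le> ennreal c * ennreal (p (1, B) / (k * c))"
    by (rule mult_left_mono) simp
  also have "\<dots> = ennreal (p (1, B) / k)"
    using assms kB by (simp add: p_nonneg flip: ennreal_mult)
  finally show "ennreal c * ext x \<le> ennreal (p (1, B) / k)" .
qed

lemma ext_scale:
  assumes "0 < c"
  shows "ext (\<lambda>t. c * x t) = ennreal c * ext x"
proof (rule antisym)
  \<comment> \<open>The converse inequality is the one already proved, applied with factor
    \<open>1 / c\<close> to the function \<open>c * x\<close>.\<close>
  have "ennreal c * (ennreal (1 / c) * ext (\<lambda>t. c * x t)) \<le> ennreal c * ext (\<lambda>t. 1 / c * (c * x t))"
    using assms by (intro mult_left_mono ext_scale_ge) auto
  moreover have "ennreal c * ennreal (1 / c) = 1"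
    using assms by (simp flip: ennreal_mult)
  ultimately show "ext (\<lambda>t. c * x t) \<le> ennreal c * ext x"
    using assms by (simp add: mult.assoc[symmetric])
qed (rule ext_scale_ge[OF assms])

lemma N_scale: "0 < c \<Longrightarrow> N (\<lambda>t. c * x t) = c * N x"
  by (simp add: orlicz_norm_def ext_scale enn2real_mult)

lemma ext_finite:
  assumes "x \<in> L_Phi M \<Phi>"
  shows "ext x < \<infinity>"
proof -
  obtain lam where lam: "0 < lam" "I (\<lambda>t. lam * x t) < \<infinity>"
    using assms by (auto simp: L_Phi_def)
  then obtain B where "I (\<lambda>t. lam * x t) = ennreal B" "0 \<le> B"
    by (cases "I (\<lambda>t. lam * x t)") auto
  then have "ext x \<le> ennreal (p (1, B) / lam)"
    using lam by (intro ext_le) auto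
  also have "\<dots> < \<infinity>" by simp
  finally show ?thesis .
qed

lemma ext_eq_N: "x \<in> L_Phi M \<Phi> \<Longrightarrow> ext x = ennreal (N x)"
  using ext_finite[of x] by (simp add: orlicz_norm_def ennreal_enn2real_if)

lemma N_mono:
  assumes "AE t in M. \<bar>x t\<bar> \<le> \<bar>y t\<bar>" "y \<in> L_Phi M \<Phi>"
  shows "N x \<le> N y"
  unfolding orlicz_norm_def using ext_mono[OF assms(1)] ext_finite[OF assms(2)]
  by (intro enn2real_mono) auto

lemma E_subset_L: "E_Phi M \<Phi> \<subseteq> L_Phi M \<Phi>"
  unfolding E_Phi_def L_Phi_def by (auto intro: exI[of _ 1] zero_less_one)

text \<open>For \<open>k \<le> 2\<close> the first coordinate alone contributes
  \<open>1 / k \<ge> 1 / 2\<close>. For larger \<open>k\<close>, monotonicity of slopes gives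
  \<open>I (k x) \<ge> k / 2\<close>, and the second coordinate suffices.\<close>

lemma ext_ge_half:
  assumes [measurable]: "x \<in> borel_measurable M" and "1 \<le> I (\<lambda>t. 2 * x t)"
  shows "ennreal (1 / 2) \<le> ext x"
proof (rule ext_ge)
  fix k B assume kB: "0 < k" "0 \<le> B" "I (\<lambda>t. k * x t) = ennreal B"
  have "1 / 2 \<le> p (1, B) / k"
  proof (cases "k \<le> 2")
    case True
    then show ?thesis using kB p_ge_fst[of B] by (simp add: field_simps)
  next
    case False
    have "ennreal k * 1 \<le> ennreal k * I (\<lambda>t. 2 * x t)"
      using assms by (intro mult_left_mono) auto
    also have "\<dots> \<le> ennreal 2 * I (\<lambda>t. k * x t)"
      using False by (intro I_slope_mono) auto
    finally have "ennreal k \<le> ennreal (2 * B)"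
      using kB by (simp add: ennreal_mult)
    then have "k \<le> 2 * B"
      using kB by (subst (asm) ennreal_le_iff) auto
    then show ?thesis using kB p_ge_snd[of B] by (simp add: field_simps)
  qed
  then show "ennreal (1 / 2) \<le> ennreal (p (1, B) / k)" by (rule ennreal_leI)
qed

lemma N_indicator_pos:
  assumes B: "B \<in> sets M" "0 < emeasure M B" "emeasure M B < \<infinity>"
  shows "0 < N (indicator B)"
proof -
  obtain b where b: "emeasure M B = ennreal b" "0 < b"
    using B by (cases "emeasure M B") auto
  \<comment> \<open>Stretching the indicator by \<open>u\<close> makes its modular at least
    \<open>1\<close>, so \<open>ext_ge_half\<close> applies to \<open>u / 2\<close> times the
    indicator.\<close>
  obtain u where u: "0 < u" "1 / b \<le> \<Phi> u"
    using orlicz_unbounded[OF \<Phi>] by blast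
  have "1 \<le> \<Phi> u * b"
    using u b by (simp add: field_simps)
  then have "1 \<le> I (\<lambda>t. 2 * (u / 2 * indicator B t))"
    using I_indicator[OF B(1), of u] b orlicz_nonneg[OF \<Phi>, of u]
    by (simp flip: ennreal_mult)
  then have "ennreal (1 / 2) \<le> ext (\<lambda>t. u / 2 * indicator B t)"
    using B by (intro ext_ge_half) auto
  also have "\<dots> = ennreal (u / 2) * ext (indicator B)"
    using u by (intro ext_scale) auto
  finally have "ext (indicator B) \<noteq> 0" by auto
  moreover have "ext (indicator B) < \<infinity>"
    using indicator_in_E[OF B(1,3), of 1] E_subset_L by (intro ext_finite) auto
  ultimately show ?thesis
    by (simp add: orlicz_norm_def enn2real_positive_iff zero_less_iff_neq_zero)
qed

end

subsection \<open>The growth condition forces uniform monotonicity\<close>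

context orlicz_amemiya
begin

lemma atom_le_I:
  assumes "{a} \<in> sets M" "emeasure M {a} = 1"
  shows "ennreal (\<Phi> (x a)) \<le> I x"
proof -
  have "ennreal (\<Phi> (x a)) = (\<integral>\<^sup>+t. ennreal (\<Phi> (x a)) * indicator {a} t \<partial>M)"
    using assms by (simp add: nn_integral_cmult_indicator)
  also have "\<dots> \<le> I x"
    unfolding I_Phi_def by (intro nn_integral_mono) (auto simp: indicator_def)
  finally show ?thesis .
qed

text \<open>On the pieces of infinite measure the growth condition bounds \<open>\<Phi> (k * x t)\<close> by a multiple of
  \<open>\<Phi> (x t)\<close>; on those of finite measure the values of \<open>x\<close> below a threshold \<open>d\<close> are absorbed
  by the constant \<open>\<Phi> (k * d)\<close>. At an atom, a small modular already makes \<open>x\<close> small.\<close>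

lemma modular_small:
  assumes sp: "admissible_space M Ona A" and pos: "\<And>u. 0 < u \<Longrightarrow> 0 < \<Phi> u"
    and d2: "suitable_delta2 M Ona A \<Phi>" and k: "0 < k"
  obtains c where "0 < c"
    "\<And>x. x \<in> borel_measurable M \<Longrightarrow> I x \<le> ennreal c \<Longrightarrow> I (\<lambda>t. k * x t) \<le> 1"
proof -
  have Ona: "Ona \<in> sets M" and cA: "countable A" and sU: "space M = Ona \<union> A"
    and atom: "\<And>a. a \<in> A \<Longrightarrow> {a} \<in> sets M \<and> emeasure M {a} = 1"
    and kind: "Ona = {} \<or> 0 < emeasure M Ona"
    using sp by (auto simp: admissible_space_def)
  have A: "A \<in> sets M"
    using sets.countable[of A M] atom cA by blast
  \<comment> \<open>\<open>F\<close> collects the pieces of finite measure; only there may an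
    additive constant be integrated.\<close>
  define F where "F = (if emeasure M Ona = \<infinity> then {} else Ona) \<union> (if infinite A then {} else A)"
  have F: "F \<in> sets M" using Ona A by (auto simp: F_def)
  have "emeasure M A < \<infinity>" if "finite A"
    using that atom by (subst emeasure_eq_sum_singleton) (auto simp: of_nat_less_top)
  then have "emeasure M F < \<infinity>"
    using emeasure_subadditive[OF Ona A] Ona A
    by (auto simp: F_def top.not_eq_extremum intro: order_le_less_trans)
  then obtain f where f: "emeasure M F = ennreal f" "0 \<le> f"
    by (cases "emeasure M F") auto
  \<comment> \<open>Continuity of \<Phi> at \<open>0\<close> makes the constant cost at most half of
    the allowed modular \<open>1\<close>; \<open>f + 1\<close> avoids dividing by zero.\<close>
  have "\<exists>d>0. \<Phi> (k * d) * (f + 1) \<le> 1 / 2"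
  proof -
    have "isCont \<Phi> 0"
      using orlicz_continuous[OF \<Phi>] by (simp add: continuous_on_eq_continuous_at)
    then have "\<exists>e>0. \<forall>u. dist u 0 < e \<longrightarrow> dist (\<Phi> u) (\<Phi> 0) < 1 / (2 * (f + 1))"
      using f by (auto simp: continuous_at_eps_delta)
    then obtain e where e: "0 < e" "\<And>u. \<bar>u\<bar> < e \<Longrightarrow> \<Phi> u < 1 / (2 * (f + 1))"
      using orlicz_nonneg[OF \<Phi>] by (auto simp: dist_real_def orlicz_zero[OF \<Phi>])
    have "\<Phi> (k * (e / (2 * k))) < 1 / (2 * (f + 1))"
      using e(1) k by (intro e(2)) auto
    then have "\<Phi> (k * (e / (2 * k))) * (f + 1) \<le> 1 / 2"
      using f by (simp add: field_simps)
    moreover have "0 < e / (2 * k)" using e k by simp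
    ultimately show ?thesis by blast
  qed
  then obtain d where d: "0 < d" "\<Phi> (k * d) * (f + 1) \<le> 1 / 2" by blast
  have "\<Phi> (k * d) * f \<le> \<Phi> (k * d) * (f + 1)"
    using orlicz_nonneg[OF \<Phi>] by (intro mult_left_mono) auto
  with d have df: "\<Phi> (k * d) * f \<le> 1 / 2" by linarith
  \<comment> \<open>The factor \<open>k\<close> is dominated by \<open>m\<close> doublings.\<close>
  obtain m :: nat where m: "k < 2 ^ m"
    using real_arch_pow[of 2 k] by auto
  have km: "\<Phi> (k * x) \<le> \<Phi> (2 ^ m * \<bar>x\<bar>)" for x
    using m k by (intro orlicz_mono[OF \<Phi>]) (auto simp: abs_mult intro!: mult_right_mono)
  have below: "\<Phi> (k * x) \<le> \<Phi> (k * d)" if "\<bar>x\<bar> \<le> d" for x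
    using that k by (intro orlicz_mono[OF \<Phi>]) (auto simp: abs_mult)
  have "\<exists>C>0. \<forall>t\<in>Ona. \<forall>x. \<Phi> (k * x) \<le> C * \<Phi> x + \<Phi> (k * d) * indicator F t"
  proof (cases "Ona = {}")
    case False
    then have p0: "0 < emeasure M Ona" using kind by auto
    show ?thesis
    proof (cases "emeasure M Ona = \<infinity>")
      case True
      then obtain K where K: "0 < K" "\<And>u. 0 \<le> u \<Longrightarrow> \<Phi> (2 * u) \<le> K * \<Phi> u"
        using d2 p0 by (auto simp: suitable_delta2_def delta2_Rplus_def)
      have "\<Phi> (k * x) \<le> K ^ m * \<Phi> x + \<Phi> (k * d) * indicator F t" for x t
      proof -
        have "\<Phi> (2 ^ m * \<bar>x\<bar>) \<le> K ^ m * \<Phi> \<bar>x\<bar>"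
          by (rule delta2_iterate_above[of 0]) (use K in auto)
        moreover have "0 \<le> \<Phi> (k * d) * indicator F t"
          by (simp add: orlicz_nonneg[OF \<Phi>])
        ultimately show ?thesis
          using km[of x] by (simp add: orlicz_abs[OF \<Phi>])
      qed
      then show ?thesis using K by (intro exI[of _ "K ^ m"]) auto
    next
      case fin: False
      then have "delta2_infty \<Phi>" using d2 p0 by (auto simp: suitable_delta2_def)
      then obtain K where K: "0 < K" "\<And>u. d \<le> u \<Longrightarrow> \<Phi> (2 * u) \<le> K * \<Phi> u"
        using delta2_infty_extend[OF \<Phi> _ pos d(1)] by metis
      have "\<Phi> (k * x) \<le> K ^ m * \<Phi> x + \<Phi> (k * d) * indicator F t" if "t \<in> Ona" for x t
      proof (cases "\<bar>x\<bar> \<le> d")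
        case True
        moreover have "t \<in> F" using that fin by (auto simp: F_def)
        moreover have "0 \<le> K ^ m * \<Phi> x" using K orlicz_nonneg[OF \<Phi>] by simp
        ultimately show ?thesis using below[of x] by simp
      next
        case False
        have "\<Phi> (2 ^ m * \<bar>x\<bar>) \<le> K ^ m * \<Phi> \<bar>x\<bar>"
          by (rule delta2_iterate_above[of d]) (use K d False in auto)
        moreover have "0 \<le> \<Phi> (k * d) * indicator F t"
          by (simp add: orlicz_nonneg[OF \<Phi>])
        ultimately show ?thesis
          using km[of x] by (simp add: orlicz_abs[OF \<Phi>])
      qed
      then show ?thesis using K by (intro exI[of _ "K ^ m"]) auto
    qed
  qed (auto intro: exI[of _ 1])
  then obtain C1 where C1: "0 < C1"
      "\<And>t x. t \<in> Ona \<Longrightarrow> \<Phi> (k * x) \<le> C1 * \<Phi> x + \<Phi> (k * d) * indicator F t" by blast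
  have "\<exists>C>0. \<exists>v>0. \<forall>t\<in>A. \<forall>x. \<bar>x\<bar> \<le> v \<longrightarrow> \<Phi> (k * x) \<le> C * \<Phi> x + \<Phi> (k * d) * indicator F t"
  proof (cases "infinite A")
    case True
    then obtain u0 K where K: "0 < u0" "0 < K" "\<And>u. 0 \<le> u \<Longrightarrow> u \<le> u0 \<Longrightarrow> \<Phi> (2 * u) \<le> K * \<Phi> u"
      using d2 by (auto simp: suitable_delta2_def delta2_zero_def)
    \<comment> \<open>The bound \<open>u0 / 2 ^ m\<close> keeps all \<open>m\<close> doublings
      inside the range of the condition at zero.\<close>
    have "\<Phi> (k * x) \<le> K ^ m * \<Phi> x + \<Phi> (k * d) * indicator F t" if "\<bar>x\<bar> \<le> u0 / 2 ^ m" for x t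
    proof -
      have "\<Phi> (2 ^ m * \<bar>x\<bar>) \<le> K ^ m * \<Phi> \<bar>x\<bar>"
        by (rule delta2_iterate_below[of u0]) (use K that in \<open>auto simp: field_simps\<close>)
      moreover have "0 \<le> \<Phi> (k * d) * indicator F t"
        by (simp add: orlicz_nonneg[OF \<Phi>])
      ultimately show ?thesis
        using km[of x] by (simp add: orlicz_abs[OF \<Phi>])
    qed
    moreover have "0 < K ^ m" "0 < u0 / 2 ^ m" using K by auto
    ultimately show ?thesis by blast
  next
    case False
    have "\<Phi> (k * x) \<le> 1 * \<Phi> x + \<Phi> (k * d) * indicator F t" if "t \<in> A" "\<bar>x\<bar> \<le> d" for x t
      using that False below[of x] orlicz_nonneg[OF \<Phi>, of x] by (simp add: F_def)
    then show ?thesis using d(1) zero_less_one by blast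
  qed
  then obtain C2 v where C2: "0 < C2" "0 < v"
      "\<And>t x. t \<in> A \<Longrightarrow> \<bar>x\<bar> \<le> v \<Longrightarrow> \<Phi> (k * x) \<le> C2 * \<Phi> x + \<Phi> (k * d) * indicator F t" by blast
  define C where "C = max C1 C2"
  have C: "0 < C" "C1 \<le> C" "C2 \<le> C" using C1 by (auto simp: C_def)
  \<comment> \<open>The first entry forces the values of \<open>x\<close> at atoms below
    \<open>v\<close>, since each of them contributes to the modular with mass \<open>1\<close>; the
    second leaves the other half of the modular bound for the additive constant.\<close>
  define c where "c = min (\<Phi> v / 2) (1 / (2 * C))"
  have c: "0 < c" "c < \<Phi> v" "C * c \<le> 1 / 2"
  proof -
    have "0 < \<Phi> v" using pos C2 by blast
    then show "0 < c" "c < \<Phi> v" using C by (auto simp: c_def)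
    have "C * c \<le> C * (1 / (2 * C))" using C by (intro mult_left_mono) (auto simp: c_def)
    then show "C * c \<le> 1 / 2" using C by simp
  qed
  have "I (\<lambda>t. k * x t) \<le> 1" if [measurable]: "x \<in> borel_measurable M" and Ix: "I x \<le> ennreal c" for x
  proof -
    have [measurable]: "F \<in> sets M" by (rule F)
    have pt: "\<Phi> (k * x t) \<le> C * \<Phi> (x t) + \<Phi> (k * d) * indicator F t" if "t \<in> space M" for t
    proof -
      have "C1 * \<Phi> (x t) \<le> C * \<Phi> (x t)" "C2 * \<Phi> (x t) \<le> C * \<Phi> (x t)"
        using C orlicz_nonneg[OF \<Phi>] by (auto intro: mult_right_mono)
      moreover have "\<bar>x t\<bar> \<le> v" if "t \<in> A"
      proof (rule ccontr)
        assume "\<not> \<bar>x t\<bar> \<le> v"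
        then have "\<Phi> v \<le> \<Phi> (x t)" using C2 by (intro orlicz_mono[OF \<Phi>]) auto
        moreover have "ennreal (\<Phi> (x t)) \<le> ennreal c"
          using atom_le_I[of t x] atom[OF that] Ix by (metis order_trans)
        ultimately show False using c by simp
      qed
      ultimately show ?thesis
        using C1(2)[of t "x t"] C2(3)[of t "x t"] that sU by force
    qed
    have "I (\<lambda>t. k * x t) \<le> (\<integral>\<^sup>+t. ennreal C * ennreal (\<Phi> (x t)) + ennreal (\<Phi> (k * d)) * indicator F t \<partial>M)"
      unfolding I_Phi_def
    proof (rule nn_integral_mono)
      fix t assume "t \<in> space M"
      then have "ennreal (\<Phi> (k * x t)) \<le> ennreal (C * \<Phi> (x t) + \<Phi> (k * d) * indicator F t)"
        by (intro ennreal_leI pt)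
      also have "\<dots> = ennreal C * ennreal (\<Phi> (x t)) + ennreal (\<Phi> (k * d)) * indicator F t"
        using C orlicz_nonneg[OF \<Phi>] by (simp add: ennreal_mult indicator_def)
      finally show "ennreal (\<Phi> (k * x t)) \<le> \<dots>" .
    qed
    also have "\<dots> = ennreal C * I x + ennreal (\<Phi> (k * d)) * emeasure M F"
      unfolding I_Phi_def using F
      by (subst nn_integral_add) (auto simp: nn_integral_cmult nn_integral_cmult_indicator)
    also have "\<dots> \<le> ennreal C * ennreal c + ennreal (\<Phi> (k * d)) * ennreal f"
      using Ix f by (intro add_mono mult_left_mono) auto
    also have "\<dots> = ennreal (C * c + \<Phi> (k * d) * f)"
      using C c f orlicz_nonneg[OF \<Phi>] by (simp add: ennreal_mult)
    also have "\<dots> \<le> ennreal 1"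
      using c df by (intro ennreal_leI) linarith
    finally show ?thesis by simp
  qed
  then show ?thesis using that c by blast
qed

lemma delta2_imp_uniformly_monotone:
  assumes sp: "admissible_space M Ona A" and strict: "strictly_monotone_R2 p"
    and a0: "a_Phi \<Phi> = 0" and d2: "suitable_delta2 M Ona A \<Phi>"
  shows "uniformly_monotone M (L_Phi M \<Phi>) N"
  unfolding uniformly_monotone_def
proof (intro allI impI)
  fix \<epsilon> :: real assume \<epsilon>: "0 < \<epsilon> \<and> \<epsilon> < 1"
  have pos: "\<And>u. 0 < u \<Longrightarrow> 0 < \<Phi> u"
    using a0 a_Phi_eq_0_iff[OF \<Phi>] by blast
  \<comment> \<open>With the factor \<open>8 / \<epsilon>\<close>, a modular of \<open>x / 2\<close>
    not exceeding \<open>c\<close> would give \<open>I (4 x / \<epsilon>) \<le> 1\<close>, hence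
    norm at most \<open>p (1, 1) * \<epsilon> / 4 \<le> \<epsilon> / 2\<close>.\<close>
  obtain c where c: "0 < c" "\<And>x. x \<in> borel_measurable M \<Longrightarrow> I x \<le> ennreal c \<Longrightarrow> I (\<lambda>t. 8 / \<epsilon> * x t) \<le> 1"
    using modular_small[OF sp pos d2, of "8 / \<epsilon>"] \<epsilon> by auto
  obtain \<delta> where \<delta>: "0 < \<delta>" "\<And>a b e. 0 \<le> a \<Longrightarrow> a \<le> 2 \<Longrightarrow> c \<le> e \<Longrightarrow> e \<le> b \<Longrightarrow> b \<le> 2 \<Longrightarrow> p (a, b - e) + \<delta> \<le> p (a, b)"
    using p_uniform_gap[OF strict c(1)] by metis
  \<comment> \<open>The near-optimal scale loses at most \<eta>, while the gap gains at least
    \<open>2 * \<eta>\<close>; the cap \<open>1\<close> keeps \<open>1 / k\<close> and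
    \<open>B / k\<close> in the rectangle of \<open>p_uniform_gap\<close>.\<close>
  define \<eta> where "\<eta> = min 1 (\<delta> / 2)"
  have \<eta>: "0 < \<eta>" "\<eta> \<le> 1" "\<eta> \<le> \<delta> / 2" using \<delta> by (auto simp: \<eta>_def)
  have "N (\<lambda>t. y t - x t) \<le> 1 - \<eta> / 2"
    if xy: "x \<in> L_Phi M \<Phi>" "y \<in> L_Phi M \<Phi>" and le: "AE t in M. 0 \<le> x t \<and> x t \<le> y t"
      and Nx: "\<epsilon> \<le> N x" and Ny: "N y = 1" for x y
  proof -
    have [measurable]: "x \<in> borel_measurable M" "y \<in> borel_measurable M"
      using xy by (auto simp: L_Phi_def)
    have Ix: "ennreal c < I (\<lambda>t. 1 / 2 * x t)"
    proof (rule ccontr)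
      assume "\<not> ennreal c < I (\<lambda>t. 1 / 2 * x t)"
      then have "I (\<lambda>t. 8 / \<epsilon> * (1 / 2 * x t)) \<le> 1" by (intro c) auto
      then have "I (\<lambda>t. 4 / \<epsilon> * x t) \<le> ennreal 1" by simp
      then have "ext x \<le> ennreal (p (1, 1) / (4 / \<epsilon>))"
        using \<epsilon> by (intro ext_le) auto
      also have "\<dots> \<le> ennreal (2 / (4 / \<epsilon>))"
        using \<epsilon> p_le_sum[of 1] by (intro ennreal_leI divide_right_mono) auto
      finally have "ennreal (N x) \<le> ennreal (\<epsilon> / 2)"
        by (simp add: ext_eq_N[OF xy(1)])
      then have "N x \<le> \<epsilon> / 2" using \<epsilon> by (subst (asm) ennreal_le_iff) auto
      then show False using Nx \<epsilon> by simp
    qed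
    have "ext y < ennreal (1 + \<eta>)"
      using \<eta> by (simp add: ext_eq_N[OF xy(2)] Ny ennreal_less_iff flip: ennreal_1)
    then obtain k B where kB: "0 < k" "0 \<le> B" "I (\<lambda>t. k * y t) = ennreal B" "ennreal (p (1, B) / k) < ennreal (1 + \<eta>)"
      by (rule ext_approx)
    then have pk: "p (1, B) / k < 1 + \<eta>"
      using p_nonneg[of "(1, B)"] by (subst (asm) ennreal_less_iff) auto
    have k1: "1 / k \<le> 2"
    proof -
      have "1 / k \<le> p (1, B) / k" using kB p_ge_fst[of B] by (intro divide_right_mono) auto
      then show ?thesis using pk \<eta> by linarith
    qed
    have B1: "B / k \<le> 2"
    proof -
      have "B / k \<le> p (1, B) / k" using kB p_ge_snd[of B] by (intro divide_right_mono) auto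
      then show ?thesis using pk \<eta> by linarith
    qed
    have sup: "I (\<lambda>t. k * y t - k * x t) + I (\<lambda>t. k * x t) \<le> ennreal B"
      unfolding kB(3)[symmetric]
      using le kB(1) by (intro I_diff_add_le) (auto simp: mult_left_mono)
    have "I (\<lambda>t. k * y t - k * x t) \<le> ennreal B" "I (\<lambda>t. k * x t) \<le> ennreal B"
      using sup by (auto intro: order_trans[rotated])
    then obtain D E where DE: "I (\<lambda>t. k * y t - k * x t) = ennreal D" "0 \<le> D" "I (\<lambda>t. k * x t) = ennreal E" "0 \<le> E"
      by (cases "I (\<lambda>t. k * y t - k * x t)"; cases "I (\<lambda>t. k * x t)") (auto simp: top_unique)
    have DEB: "D + E \<le> B"
      using sup DE kB by (simp flip: ennreal_plus)
    \<comment> \<open>Since \<open>k \<ge> 1 / 2\<close>, monotonicity of slopes carries the lower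
      bound from the fixed scale \<open>1 / 2\<close> to the scale \<open>k\<close>, however large
      \<open>k\<close> is.\<close>
    have "ennreal k * ennreal c \<le> ennreal k * I (\<lambda>t. 1 / 2 * x t)"
      using Ix by (intro mult_left_mono) auto
    also have "\<dots> \<le> ennreal (1 / 2) * I (\<lambda>t. k * x t)"
      using k1 kB by (intro I_slope_mono) (auto simp: field_simps)
    finally have "ennreal (k * c) \<le> ennreal (1 / 2 * E)"
      using kB(1) c(1) DE(3,4) by (simp only: ennreal_mult less_imp_le)
    then have "k * c \<le> 1 / 2 * E"
      using DE by (subst (asm) ennreal_le_iff) auto
    then have "c \<le> E / k" using kB DE c by (simp add: field_simps)
    then have gap: "p (1 / k, B / k - E / k) + \<delta> \<le> p (1 / k, B / k)"
      using kB k1 B1 DEB DE by (intro \<delta>) (auto intro: divide_right_mono)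
    have "ext (\<lambda>t. y t - x t) \<le> ennreal (p (1, B - E) / k)"
      using kB DE DEB by (intro ext_le) (auto simp: right_diff_distrib)
    also have "\<dots> \<le> ennreal (1 - \<eta> / 2)"
    proof (rule ennreal_leI)
      have "p (1, B - E) / k = p (1 / k, B / k - E / k)" "p (1, B) / k = p (1 / k, B / k)"
        using kB by (simp_all add: p_divide diff_divide_distrib)
      then show "p (1, B - E) / k \<le> 1 - \<eta> / 2"
        using gap pk \<eta> by linarith
    qed
    finally have "enn2real (ext (\<lambda>t. y t - x t)) \<le> enn2real (ennreal (1 - \<eta> / 2))"
      by (intro enn2real_mono) auto
    then show ?thesis using \<eta> by (simp add: orlicz_norm_def)
  qed
  then show "\<exists>\<delta>>0. \<delta> < 1 \<and> (\<forall>x\<in>L_Phi M \<Phi>. \<forall>y\<in>L_Phi M \<Phi>.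
      (AE t in M. 0 \<le> x t \<and> x t \<le> y t) \<and> \<epsilon> \<le> N x \<and> N y = 1 \<longrightarrow> N (\<lambda>t. y t - x t) \<le> 1 - \<delta>)"
    using \<eta> by (intro exI[of _ "\<eta> / 2"]) auto
qed

text \<open>If \<open>y + x\<close> had norm \<open>s < 1 + \<delta>\<close>, uniform monotonicity
  for \<open>x / s\<close> below \<open>(y + x) / s\<close> would give
  \<open>1 / s \<le> 1 - \<delta>\<close>, contradicting
  \<open>(1 - \<delta>) * (1 + \<delta>) < 1\<close>.\<close>

lemma uniformly_monotone_imp_upper:
  assumes um: "uniformly_monotone M (L_Phi M \<Phi>) N"
  shows "upper_locally_uniformly_monotone M (L_Phi M \<Phi>) N"
  unfolding upper_locally_uniformly_monotone_def
proof (intro ballI allI impI)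
  fix y and \<epsilon> :: real
  assume y: "y \<in> L_Phi M \<Phi>" "(AE t in M. 0 \<le> y t) \<and> N y = 1" and \<epsilon>: "0 < \<epsilon>"
  \<comment> \<open>Because \<open>s < 2\<close>, the function \<open>x / s\<close> still has norm
    at least \<open>e\<close>.\<close>
  define e where "e = min 1 \<epsilon> / 2"
  have e: "0 < e" "e < 1" "e \<le> \<epsilon> / 2" using \<epsilon> by (auto simp: e_def)
  from um[unfolded uniformly_monotone_def, THEN spec, of e]
  obtain \<delta> where \<delta>: "0 < \<delta>" "\<delta> < 1"
    and dec: "\<forall>x\<in>L_Phi M \<Phi>. \<forall>y\<in>L_Phi M \<Phi>. (AE t in M. 0 \<le> x t \<and> x t \<le> y t) \<and> e \<le> N x \<and> N y = 1
      \<longrightarrow> N (\<lambda>t. y t - x t) \<le> 1 - \<delta>"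
    using e(1,2) by blast
  have "1 + \<delta> \<le> N (\<lambda>t. y t + x t)"
    if x: "x \<in> L_Phi M \<Phi>" "AE t in M. 0 \<le> x t" "\<epsilon> \<le> N x" for x
  proof (rule ccontr)
    define s where "s = N (\<lambda>t. y t + x t)"
    assume "\<not> 1 + \<delta> \<le> N (\<lambda>t. y t + x t)"
    then have s2: "s < 1 + \<delta>" by (simp add: s_def)
    have sum: "(\<lambda>t. y t + x t) \<in> L_Phi M \<Phi>" using y x by (intro L_add)
    have s1: "1 \<le> s"
    proof -
      have "AE t in M. \<bar>y t\<bar> \<le> \<bar>y t + x t\<bar>"
        using y(2)[THEN conjunct1] x(2) by eventually_elim auto
      then show ?thesis using N_mono[OF _ sum, of y] y by (simp add: s_def)
    qed
    have "N (\<lambda>t. 1 / s * (y t + x t) - 1 / s * x t) \<le> 1 - \<delta>"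
    proof (rule dec[THEN bspec, of "\<lambda>t. 1 / s * x t", THEN bspec, of "\<lambda>t. 1 / s * (y t + x t)", THEN mp])
      show "(\<lambda>t. 1 / s * x t) \<in> L_Phi M \<Phi>" using s1 x by (intro L_scale) auto
      show "(\<lambda>t. 1 / s * (y t + x t)) \<in> L_Phi M \<Phi>" using s1 sum by (intro L_scale) auto
      have "AE t in M. 0 \<le> 1 / s * x t \<and> 1 / s * x t \<le> 1 / s * (y t + x t)"
        using y(2)[THEN conjunct1] x(2)
        by eventually_elim (use s1 in \<open>auto intro!: divide_right_mono\<close>)
      moreover have "e * s \<le> \<epsilon> / 2 * 2"
        using e s1 s2 \<delta> by (intro mult_mono) auto
      then have "e \<le> 1 / s * N x" using s1 x(3) by (simp add: field_simps)
      then have "e \<le> N (\<lambda>t. 1 / s * x t)" using s1 by (subst N_scale) auto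
      moreover have "N (\<lambda>t. 1 / s * (y t + x t)) = 1" using s1 by (subst N_scale) (auto simp: s_def)
      ultimately show "(AE t in M. 0 \<le> 1 / s * x t \<and> 1 / s * x t \<le> 1 / s * (y t + x t)) \<and>
        e \<le> N (\<lambda>t. 1 / s * x t) \<and> N (\<lambda>t. 1 / s * (y t + x t)) = 1" by blast
    qed
    also have "(\<lambda>t. 1 / s * (y t + x t) - 1 / s * x t) = (\<lambda>t. 1 / s * y t)"
      by (auto simp: add_divide_distrib)
    finally have "1 / s \<le> 1 - \<delta>"
      using N_scale[of "1 / s" y] s1 y by simp
    then have "1 \<le> (1 - \<delta>) * s" using s1 by (simp add: field_simps)
    also have "\<dots> \<le> (1 - \<delta>) * (1 + \<delta>)" using s2 \<delta> by (intro mult_left_mono) auto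
    also have "\<dots> < 1" using \<delta> by (simp add: algebra_simps)
    finally show False by simp
  qed
  then show "\<exists>\<sigma>>0. \<forall>x\<in>L_Phi M \<Phi>. (AE t in M. 0 \<le> x t) \<and> \<epsilon> \<le> N x \<longrightarrow> 1 + \<sigma> \<le> N (\<lambda>t. y t + x t)"
    using \<delta> by blast
qed

subsection \<open>Necessity of the growth condition\<close>

text \<open>Here the hypothesis on \<open>K_set\<close> enters: the norm \<open>1\<close> is
  attained at a finite scale \<open>k\<close>, and the modular there is finite because the Amemiya
  quotient is.\<close>

lemma normalised_indicator:
  assumes K: "\<forall>x\<in>E_Phi M \<Phi>. \<not> (AE t in M. x t = 0) \<longrightarrow> K_set M \<Phi> p x \<noteq> {}"
    and D: "D \<in> sets M" "0 < emeasure M D" "emeasure M D < \<infinity>"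
  obtains r k B where "0 < r" "N (\<lambda>t. r * indicator D t) = 1" "0 < k" "0 \<le> B"
    "I (\<lambda>t. k * (r * indicator D t)) = ennreal B" "p (1, B) / k = 1"
proof -
  define r where "r = 1 / N (indicator D)"
  have r: "0 < r" using N_indicator_pos[OF D] by (simp add: r_def)
  have N1: "N (\<lambda>t. r * indicator D t) = 1"
    using r by (subst N_scale) (auto simp: r_def)
  have E: "(\<lambda>t. r * indicator D t) \<in> E_Phi M \<Phi>" using D by (intro indicator_in_E)
  have "\<not> (AE t in M. r * indicator D t = 0)"
  proof
    assume "AE t in M. r * indicator D t = 0"
    then have "AE t in M. t \<notin> D" by eventually_elim (use r in \<open>auto simp: indicator_def\<close>)
    then have "emeasure M D = 0" using D by (simp add: AE_iff_measurable[OF D(1)] sets.sets_into_space Collect_conj_eq)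
    then show False using D by simp
  qed
  then obtain k where k: "0 < k" "ext (\<lambda>t. r * indicator D t) = amemiya_term M \<Phi> p (\<lambda>t. r * indicator D t) k"
    using K E by (fastforce simp: K_set_def)
  have ext1: "ext (\<lambda>t. r * indicator D t) = 1"
    using ext_eq_N E E_subset_L N1 by (metis ennreal_1 subsetD)
  define J where "J = I (\<lambda>t. k * (r * indicator D t))"
  have "J \<noteq> \<infinity>" using k ext1 by (auto simp: amemiya_term_def Let_def J_def)
  then obtain B where B: "J = ennreal B" "0 \<le> B" by (cases J) auto
  then have "ennreal (p (1, B) / k) = 1"
    using k ext1 by (simp add: amemiya_term_def Let_def J_def)
  then have "p (1, B) / k = 1" by (simp add: ennreal_eq_1)
  then show ?thesis using that r N1 k B by (auto simp: J_def)
qed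

text \<open>With \<open>k \<in> K(y)\<close> and \<open>x\<close> disjoint from \<open>y\<close>, the norm of \<open>y + x\<close> exceeds that of \<open>y\<close> by at most
  \<open>I (k * x) / k\<close>.\<close>

lemma upper_monotone_indicator_modular:
  assumes K: "\<forall>x\<in>E_Phi M \<Phi>. \<not> (AE t in M. x t = 0) \<longrightarrow> K_set M \<Phi> p x \<noteq> {}"
    and ulm: "upper_locally_uniformly_monotone M (E_Phi M \<Phi>) N"
    and D: "D \<in> sets M" "0 < emeasure M D" "emeasure M D < \<infinity>"
  obtains k where "0 < k"
    "\<And>\<epsilon>. 0 < \<epsilon> \<Longrightarrow> \<exists>\<eta>>0. \<forall>B u m. B \<in> sets M \<and> emeasure M B = ennreal m \<and> 0 \<le> m \<and> B \<inter> D = {} \<and> 0 \<le> u \<and>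
      \<epsilon> \<le> N (\<lambda>t. u / k * indicator B t) \<longrightarrow> \<eta> \<le> \<Phi> u * m"
proof -
  obtain r k b where r: "0 < r" "N (\<lambda>t. r * indicator D t) = 1" "0 < k" "0 \<le> b"
    "I (\<lambda>t. k * (r * indicator D t)) = ennreal b" "p (1, b) / k = 1"
    using normalised_indicator[OF K D] by metis
  have yE: "(\<lambda>t. r * indicator D t) \<in> E_Phi M \<Phi>" using D by (intro indicator_in_E)
  have "\<exists>\<eta>>0. \<forall>B u m. B \<in> sets M \<and> emeasure M B = ennreal m \<and> 0 \<le> m \<and> B \<inter> D = {} \<and> 0 \<le> u \<and>
      \<epsilon> \<le> N (\<lambda>t. u / k * indicator B t) \<longrightarrow> \<eta> \<le> \<Phi> u * m" if \<epsilon>: "0 < \<epsilon>" for \<epsilon>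
  proof -
    have "AE t in M. 0 \<le> r * indicator D t" using r by simp
    then obtain \<sigma> where \<sigma>: "0 < \<sigma>" "\<And>x. x \<in> E_Phi M \<Phi> \<Longrightarrow> (AE t in M. 0 \<le> x t) \<Longrightarrow> \<epsilon> \<le> N x \<Longrightarrow>
        1 + \<sigma> \<le> N (\<lambda>t. r * indicator D t + x t)"
      using ulm yE r(2) \<epsilon> unfolding upper_locally_uniformly_monotone_def by meson
    \<comment> \<open>At scale \<open>k\<close> the test function \<open>u / k\<close> on
      \<open>B\<close> becomes \<open>u\<close> on \<open>B\<close> and adds exactly
      \<open>\<Phi> u * m\<close> to the modular, so \<open>\<sigma> * k\<close> serves as
      \<eta>.\<close>
    have "\<sigma> * k \<le> \<Phi> u * m"
      if B: "B \<in> sets M" "B \<inter> D = {}" "0 \<le> u" "\<epsilon> \<le> N (\<lambda>t. u / k * indicator B t)"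
        and m: "emeasure M B = ennreal m" "0 \<le> m" for B u m
    proof -
      define z where "z = (\<lambda>t. r * indicator D t + u / k * indicator B t)"
      have zN: "1 + \<sigma> \<le> N z"
        unfolding z_def using B r m by (intro \<sigma>(2) indicator_in_E) auto
      have "(\<lambda>t. k * z t) = (\<lambda>t. (k * r) * indicator D t + u * indicator B t)"
        using r by (auto simp: z_def distrib_left)
      then have "I (\<lambda>t. k * z t) = I (\<lambda>t. (k * r) * indicator D t) + I (\<lambda>t. u * indicator B t)"
        using I_indicator_add[of D B "k * r" u] D B by (simp add: Int_commute)
      also have "\<dots> = ennreal (b + \<Phi> u * m)"
        using r(4,5) m I_indicator[OF B(1), of u] orlicz_nonneg[OF \<Phi>, of u]
        by (simp add: mult.assoc ennreal_mult)
      finally have Iz: "I (\<lambda>t. k * z t) = ennreal (b + \<Phi> u * m)" .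
      have nn: "0 \<le> \<Phi> u * m" using m orlicz_nonneg[OF \<Phi>] by simp
      have "p (1, b + \<Phi> u * m) \<le> p (1, b) + p (0, \<Phi> u * m)"
        using p_triangle[of 1 0 b "\<Phi> u * m"] by simp
      also have "p (0, \<Phi> u * m) = \<Phi> u * m"
        using p_scale[OF nn, of 0 1] p_e2 by simp
      finally have "p (1, b + \<Phi> u * m) / k \<le> (p (1, b) + \<Phi> u * m) / k"
        using r by (intro divide_right_mono) auto
      also have "\<dots> = 1 + \<Phi> u * m / k" using r(6) by (simp add: add_divide_distrib)
      finally have pb: "p (1, b + \<Phi> u * m) / k \<le> 1 + \<Phi> u * m / k" .
      have "ext z \<le> ennreal (p (1, b + \<Phi> u * m) / k)"
        using r nn Iz by (intro ext_le) auto
      also have "\<dots> \<le> ennreal (1 + \<Phi> u * m / k)" using pb by (rule ennreal_leI)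
      finally have "enn2real (ext z) \<le> enn2real (ennreal (1 + \<Phi> u * m / k))"
        by (intro enn2real_mono) auto
      also have "\<dots> = 1 + \<Phi> u * m / k" using nn r(3) by (intro enn2real_ennreal) auto
      finally have "\<sigma> \<le> \<Phi> u * m / k" using zN by (simp add: orlicz_norm_def)
      then show ?thesis using r(3) by (simp add: field_simps)
    qed
    moreover have "0 < \<sigma> * k" using \<sigma> r by simp
    ultimately show ?thesis by blast
  qed
  then show ?thesis using that[of k] r(3) by blast
qed

text \<open>A zero \<open>u > 0\<close> of \<Phi> yields a test function on \<open>B\<close> that
  adds nothing to the modular at scale \<open>k\<close>, although its norm is positive; that norm
  serves as the \<epsilon>.\<close>

lemma upper_monotone_imp_a_Phi_zero:
  assumes K: "\<forall>x\<in>E_Phi M \<Phi>. \<not> (AE t in M. x t = 0) \<longrightarrow> K_set M \<Phi> p x \<noteq> {}"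
    and ulm: "upper_locally_uniformly_monotone M (E_Phi M \<Phi>) N"
    and D: "D \<in> sets M" "0 < emeasure M D" "emeasure M D < \<infinity>"
    and B: "B \<in> sets M" "0 < emeasure M B" "emeasure M B < \<infinity>" "B \<inter> D = {}"
  shows "a_Phi \<Phi> = 0"
  unfolding a_Phi_eq_0_iff[OF \<Phi>]
proof (intro allI impI, rule ccontr)
  fix u :: real assume "0 < u" "\<not> 0 < \<Phi> u"
  then have u: "0 < u" "\<Phi> u = 0" using orlicz_nonneg[OF \<Phi>, of u] by auto
  obtain k where k: "0 < k" "\<And>\<epsilon>. 0 < \<epsilon> \<Longrightarrow> \<exists>\<eta>>0. \<forall>B u m. B \<in> sets M \<and> emeasure M B = ennreal m \<and> 0 \<le> m \<and>
      B \<inter> D = {} \<and> 0 \<le> u \<and> \<epsilon> \<le> N (\<lambda>t. u / k * indicator B t) \<longrightarrow> \<eta> \<le> \<Phi> u * m"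
    using upper_monotone_indicator_modular[OF K ulm D] by metis
  obtain m where m: "emeasure M B = ennreal m" "0 \<le> m" using B by (cases "emeasure M B") auto
  have "0 < N (\<lambda>t. u / k * indicator B t)"
    using N_scale[of "u / k" "indicator B"] N_indicator_pos[OF B(1-3)] u k(1) by simp
  from k(2)[OF this] obtain \<eta> where \<eta>: "0 < \<eta>"
    and all: "\<forall>B' u' m'. B' \<in> sets M \<and> emeasure M B' = ennreal m' \<and> 0 \<le> m' \<and> B' \<inter> D = {} \<and> 0 \<le> u' \<and>
      N (\<lambda>t. u / k * indicator B t) \<le> N (\<lambda>t. u' / k * indicator B' t) \<longrightarrow> \<eta> \<le> \<Phi> u' * m'"
    by (elim exE conjE)
  then have "\<eta> \<le> \<Phi> u * m"
    using all[THEN spec, of B, THEN spec, of u, THEN spec, of m] B m u by simp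
  then show False using u \<eta> by simp
qed

text \<open>The lower bound \<open>1\<close> on the modular gives the indicator scaled by
  \<open>u\<close> norm at least \<open>1 / 2\<close>, hence
  \<open>\<Phi> u * m \<ge> \<eta>\<close> with \<eta> independent of \<open>u\<close>. The upper
  bound \<open>2\<close> turns this into doubling with constant \<open>2 / \<eta>\<close>. A window
  is used because unions of atoms have only integer measures.\<close>

lemma upper_monotone_imp_doubling:
  assumes K: "\<forall>x\<in>E_Phi M \<Phi>. \<not> (AE t in M. x t = 0) \<longrightarrow> K_set M \<Phi> p x \<noteq> {}"
    and ulm: "upper_locally_uniformly_monotone M (E_Phi M \<Phi>) N"
    and D: "D \<in> sets M" "0 < emeasure M D" "emeasure M D < \<infinity>"
  obtains L where "0 < L" "\<And>u B m. 0 \<le> u \<Longrightarrow> B \<in> sets M \<Longrightarrow> B \<inter> D = {} \<Longrightarrow> emeasure M B = ennreal m \<Longrightarrow> 0 \<le> m \<Longrightarrow>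
      1 \<le> \<Phi> (2 * u) * m \<Longrightarrow> \<Phi> (2 * u) * m \<le> 2 \<Longrightarrow> \<Phi> (2 * u) \<le> L * \<Phi> u"
proof -
  obtain k where k: "0 < k" "\<And>\<epsilon>. 0 < \<epsilon> \<Longrightarrow> \<exists>\<eta>>0. \<forall>B u m. B \<in> sets M \<and> emeasure M B = ennreal m \<and> 0 \<le> m \<and>
      B \<inter> D = {} \<and> 0 \<le> u \<and> \<epsilon> \<le> N (\<lambda>t. u / k * indicator B t) \<longrightarrow> \<eta> \<le> \<Phi> u * m"
    using upper_monotone_indicator_modular[OF K ulm D] by metis
  have "0 < 1 / (2 * k)" using k by simp
  from k(2)[OF this] obtain \<eta> where \<eta>: "0 < \<eta>" "\<And>B u m. B \<in> sets M \<Longrightarrow> emeasure M B = ennreal m \<Longrightarrow> 0 \<le> m \<Longrightarrow>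
      B \<inter> D = {} \<Longrightarrow> 0 \<le> u \<Longrightarrow> 1 / (2 * k) \<le> N (\<lambda>t. u / k * indicator B t) \<Longrightarrow> \<eta> \<le> \<Phi> u * m"
    by blast
  have "\<Phi> (2 * u) \<le> 2 / \<eta> * \<Phi> u"
    if u: "0 \<le> u" "B \<in> sets M" "B \<inter> D = {}" "emeasure M B = ennreal m" "0 \<le> m"
      "1 \<le> \<Phi> (2 * u) * m" "\<Phi> (2 * u) * m \<le> 2" for u B m
  proof -
    have "I (\<lambda>t. 2 * (u * indicator B t)) = ennreal (\<Phi> (2 * u) * m)"
      using I_indicator[OF u(2), of "2 * u"] u(4,5) orlicz_nonneg[OF \<Phi>]
      by (simp add: mult.assoc ennreal_mult)
    then have "1 \<le> I (\<lambda>t. 2 * (u * indicator B t))"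
      using u(6) by simp
    then have "ennreal (1 / 2) \<le> ext (\<lambda>t. u * indicator B t)"
      using u(2) by (intro ext_ge_half) auto
    also have "\<dots> = ennreal (N (\<lambda>t. u * indicator B t))"
      using indicator_in_E[OF u(2), of u] u(4) E_subset_L by (intro ext_eq_N) auto
    finally have half: "1 / 2 \<le> N (\<lambda>t. u * indicator B t)"
      by (subst (asm) ennreal_le_iff) (auto simp: orlicz_norm_def)
    have "N (\<lambda>t. u / k * indicator B t) = 1 / k * N (\<lambda>t. u * indicator B t)"
      using N_scale[of "1 / k" "\<lambda>t. u * indicator B t"] k(1) by simp
    then have "1 / (2 * k) \<le> N (\<lambda>t. u / k * indicator B t)"
      using half k(1) by (simp add: field_simps)
    then have "\<eta> \<le> \<Phi> u * m" using u by (intro \<eta>(2)) auto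
    then have "2 / \<eta> * \<eta> \<le> 2 / \<eta> * (\<Phi> u * m)"
      using \<eta>(1) by (intro mult_left_mono) auto
    then have "\<Phi> (2 * u) * m \<le> (2 / \<eta> * \<Phi> u) * m"
      using u(7) \<eta>(1) by simp
    moreover have "0 < m" using u(5,6) by (cases "m = 0") auto
    ultimately show ?thesis by (rule mult_right_le_imp_le)
  qed
  moreover have "0 < 2 / \<eta>" using \<eta>(1) by simp
  ultimately show ?thesis by (rule that[rotated])
qed

section \<open>Test sets in the non-atomic part and among the atoms\<close>

lemma nonatomic_doubling:
  assumes na: "nonatomic_on M S" and C: "C \<in> sets M" "C \<subseteq> S" "C \<inter> D = {}"
    and sf: "sigma_finite_measure M"
    and L: "\<And>u B m. 0 \<le> u \<Longrightarrow> B \<in> sets M \<Longrightarrow> B \<inter> D = {} \<Longrightarrow> emeasure M B = ennreal m \<Longrightarrow> 0 \<le> m \<Longrightarrow>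
      1 \<le> \<Phi> (2 * u) * m \<Longrightarrow> \<Phi> (2 * u) * m \<le> 2 \<Longrightarrow> \<Phi> (2 * u) \<le> L * \<Phi> u"
    and u: "0 \<le> u" "0 < \<Phi> (2 * u)" "ennreal (1 / \<Phi> (2 * u)) < emeasure M C"
  shows "\<Phi> (2 * u) \<le> L * \<Phi> u"
proof -
  obtain C' where C': "C' \<in> sets M" "C' \<subseteq> C" "ennreal (1 / \<Phi> (2 * u)) < emeasure M C'" "emeasure M C' < \<infinity>"
    using sigma_finite_subset_finite_ge[OF sf C(1) u(3)] by blast
  have "0 < 1 / \<Phi> (2 * u)" "C' \<subseteq> S" using u C C' by auto
  then obtain B where B: "B \<in> sets M" "B \<subseteq> C'" "ennreal (1 / \<Phi> (2 * u)) \<le> emeasure M B"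
      "emeasure M B \<le> ennreal (2 * (1 / \<Phi> (2 * u)))"
    using nonatomic_subset_between[OF na C'(1) _ C'(4) _ less_imp_le[OF C'(3)]] by blast
  then obtain m where m: "emeasure M B = ennreal m" "0 \<le> m"
    by (cases "emeasure M B") (auto simp: top_unique)
  have "1 / \<Phi> (2 * u) \<le> m" using B(3) m u(2) by simp
  moreover have "m \<le> 2 * (1 / \<Phi> (2 * u))"
    using B(4) m u(2) by (subst (asm) m(1), subst (asm) ennreal_le_iff) auto
  ultimately have "1 \<le> \<Phi> (2 * u) * m" "\<Phi> (2 * u) * m \<le> 2"
    using u(2) by (simp_all add: field_simps)
  then show ?thesis using L[of u B m] u B m C C' by blast
qed

text \<open>One piece carries the normalised indicator, the other leaves room for test functions
  disjoint from it.\<close>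

lemma nonatomic_split:
  assumes na: "nonatomic_on M S" and sf: "sigma_finite_measure M" and S: "S \<in> sets M" "0 < emeasure M S"
  obtains D B where "D \<in> sets M" "D \<subseteq> S" "0 < emeasure M D" "emeasure M D < \<infinity>"
    "B \<in> sets M" "B \<subseteq> S" "0 < emeasure M B" "emeasure M B < \<infinity>" "B \<inter> D = {}"
proof -
  obtain C where C: "C \<in> sets M" "C \<subseteq> S" "0 < emeasure M C" "emeasure M C < \<infinity>"
    using sigma_finite_subset_finite_ge[OF sf S] by blast
  then obtain D where D: "D \<in> sets M" "D \<subseteq> C" "0 < emeasure M D" "emeasure M D < emeasure M C"
    using na unfolding nonatomic_on_def by blast
  have "emeasure M D + emeasure M (C - D) = emeasure M C"
    using plus_emeasure[of D M "C - D"] C D by (simp add: Un_absorb1)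
  then have "0 < emeasure M (C - D)"
    using D by (cases "emeasure M (C - D) = 0") (auto simp: zero_less_iff_neq_zero)
  moreover have "emeasure M (C - D) \<le> emeasure M C" using C D by (intro emeasure_mono) auto
  then have "emeasure M (C - D) < \<infinity>" using C(4) by (rule order_le_less_trans)
  moreover have "emeasure M D < \<infinity>" using D(4) C(4) by (rule less_trans)
  ultimately show ?thesis
    using that[of D "C - D"] C D by blast
qed

lemma upper_monotone_imp_nonatomic_delta2:
  assumes K: "\<forall>x\<in>E_Phi M \<Phi>. \<not> (AE t in M. x t = 0) \<longrightarrow> K_set M \<Phi> p x \<noteq> {}"
    and ulm: "upper_locally_uniformly_monotone M (E_Phi M \<Phi>) N"
    and na: "nonatomic_on M S" and sf: "sigma_finite_measure M" and S: "S \<in> sets M" "0 < emeasure M S"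
  shows "if emeasure M S = \<infinity> then delta2_Rplus \<Phi> else delta2_infty \<Phi>"
proof -
  obtain D B where D: "D \<in> sets M" "D \<subseteq> S" "0 < emeasure M D" "emeasure M D < \<infinity>"
    and B: "B \<in> sets M" "B \<subseteq> S" "0 < emeasure M B" "emeasure M B < \<infinity>" "B \<inter> D = {}"
    using nonatomic_split[OF na sf S] by metis
  obtain L where L: "0 < L" "\<And>u B m. 0 \<le> u \<Longrightarrow> B \<in> sets M \<Longrightarrow> B \<inter> D = {} \<Longrightarrow> emeasure M B = ennreal m \<Longrightarrow> 0 \<le> m \<Longrightarrow>
      1 \<le> \<Phi> (2 * u) * m \<Longrightarrow> \<Phi> (2 * u) * m \<le> 2 \<Longrightarrow> \<Phi> (2 * u) \<le> L * \<Phi> u"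
    by (rule upper_monotone_imp_doubling[OF K ulm D(1,3,4)]) (rule that)
  show ?thesis
  proof (cases "emeasure M S = \<infinity>")
    case True
    have "emeasure M D + emeasure M (S - D) = emeasure M S"
      using plus_emeasure[of D M "S - D"] S D by (simp add: Un_absorb1)
    \<comment> \<open>Infinite room outside \<open>D\<close> makes test sets of measure about
      \<open>1 / \<Phi> (2 * u)\<close> available for arbitrarily small \<open>u\<close>.\<close>
    then have inf: "emeasure M (S - D) = \<infinity>" using True D(4) by auto
    have "\<Phi> (2 * u) \<le> L * \<Phi> u" if "0 \<le> u" for u
    proof (cases "\<Phi> (2 * u) = 0")
      case True
      then show ?thesis using L(1) orlicz_nonneg[OF \<Phi>, of u] by simp
    next
      case False
      then have "0 < \<Phi> (2 * u)" using orlicz_nonneg[OF \<Phi>, of "2 * u"] by simp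
      then show ?thesis
        using that inf S D by (intro nonatomic_doubling[OF na _ _ _ sf L(2), of "S - D"]) auto
    qed
    then show ?thesis using True L(1) by (auto simp: delta2_Rplus_def)
  next
    case False
    obtain b where b: "emeasure M B = ennreal b" "0 < b" using B by (cases "emeasure M B") auto
    \<comment> \<open>Beyond \<open>w\<close> the required measure \<open>1 / \<Phi> (2 * u)\<close>
      is at most \<open>b / 2\<close>, so the test set fits into \<open>B\<close>.\<close>
    obtain w where w: "0 < w" "2 / b \<le> \<Phi> w" using orlicz_unbounded[OF \<Phi>] by blast
    have "\<Phi> (2 * u) \<le> L * \<Phi> u" if "w \<le> u" for u
    proof -
      have "\<Phi> w \<le> \<Phi> (2 * u)" using w that by (intro orlicz_mono[OF \<Phi>]) auto
      then have ge: "2 / b \<le> \<Phi> (2 * u)" using w by linarith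
      moreover have "0 < 2 / b" using b by simp
      ultimately have pos: "0 < \<Phi> (2 * u)" by linarith
      have "1 / \<Phi> (2 * u) < b" using ge b pos by (simp add: field_simps)
      then have "ennreal (1 / \<Phi> (2 * u)) < emeasure M B"
        using b pos by (simp add: ennreal_less_iff)
      then show ?thesis
        using that w pos B by (intro nonatomic_doubling[OF na _ _ _ sf L(2), of B]) auto
    qed
    then show ?thesis using False L(1) w(1) by (auto simp: delta2_infty_def)
  qed
qed

lemma upper_monotone_imp_delta2_zero:
  assumes K: "\<forall>x\<in>E_Phi M \<Phi>. \<not> (AE t in M. x t = 0) \<longrightarrow> K_set M \<Phi> p x \<noteq> {}"
    and ulm: "upper_locally_uniformly_monotone M (E_Phi M \<Phi>) N"
    and A: "infinite A" "\<And>a. a \<in> A \<Longrightarrow> {a} \<in> sets M \<and> emeasure M {a} = 1"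
  shows "delta2_zero \<Phi>"
proof -
  obtain a where a: "a \<in> A" using A(1) by (metis finite.emptyI ex_in_conv)
  have D: "{a} \<in> sets M" "0 < emeasure M {a}" "emeasure M {a} < \<infinity>" using A(2)[OF a] by auto
  obtain L where L: "0 < L" "\<And>u B m. 0 \<le> u \<Longrightarrow> B \<in> sets M \<Longrightarrow> B \<inter> {a} = {} \<Longrightarrow> emeasure M B = ennreal m \<Longrightarrow> 0 \<le> m \<Longrightarrow>
      1 \<le> \<Phi> (2 * u) * m \<Longrightarrow> \<Phi> (2 * u) * m \<le> 2 \<Longrightarrow> \<Phi> (2 * u) \<le> L * \<Phi> u"
    by (rule upper_monotone_imp_doubling[OF K ulm D]) (rule that)
  obtain w where w: "0 < w" "1 \<le> \<Phi> w" using orlicz_unbounded[OF \<Phi>] by blast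
  \<comment> \<open>Shrinking \<open>w\<close> by the factor \<open>1 / \<Phi> w \<le> 1\<close>
    brings the value of \<Phi> down to at most \<open>1\<close>.\<close>
  define v where "v = w / \<Phi> w / 2"
  have v: "0 < v" "\<Phi> (2 * v) \<le> 1"
    using w orlicz_scale_le[OF \<Phi>, of "1 / \<Phi> w" w] by (auto simp: v_def)
  have "\<Phi> (2 * u) \<le> L * \<Phi> u" if u: "0 \<le> u" "u \<le> v" for u
  proof (cases "\<Phi> (2 * u) = 0")
    case True
    then show ?thesis using L(1) orlicz_nonneg[OF \<Phi>, of u] by simp
  next
    case False
    then have pos: "0 < \<Phi> (2 * u)" using orlicz_nonneg[OF \<Phi>, of "2 * u"] by simp
    have "\<Phi> (2 * u) \<le> \<Phi> (2 * v)" using u by (intro orlicz_mono[OF \<Phi>]) auto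
    then have le1: "\<Phi> (2 * u) \<le> 1" using v by linarith
    \<comment> \<open>Rounding up adds less than one atom, that is, at most
      \<open>\<Phi> (2 * u) \<le> 1\<close> to the modular, so the window from \<open>1\<close> to
      \<open>2\<close> is met.\<close>
    define n where "n = nat \<lceil>1 / \<Phi> (2 * u)\<rceil>"
    have n: "1 / \<Phi> (2 * u) \<le> n" "n \<le> 1 / \<Phi> (2 * u) + 1"
      using pos by (auto simp: n_def)
    have "infinite (A - {a})" using A(1) by simp
    then obtain B where B: "finite B" "card B = n" "B \<subseteq> A - {a}"
      using infinite_arbitrarily_large by metis
    have Bs: "B \<in> sets M"
      using sets.countable[of B M] A(2) B by (auto simp: countable_finite)
    have "emeasure M B = (\<Sum>x\<in>B. emeasure M {x})"
      using B A(2) by (intro emeasure_eq_sum_singleton) auto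
    also have "\<dots> = (\<Sum>x\<in>B. 1)" using B A(2) by (intro sum.cong) auto
    also have "\<dots> = ennreal (real n)" using B by (simp add: ennreal_of_nat_eq_real_of_nat)
    finally have eB: "emeasure M B = ennreal (real n)" .
    have "1 \<le> \<Phi> (2 * u) * n" using n(1) pos by (simp add: field_simps)
    moreover have "\<Phi> (2 * u) * n \<le> \<Phi> (2 * u) * (1 / \<Phi> (2 * u) + 1)"
      using n(2) pos by (intro mult_left_mono) auto
    then have "\<Phi> (2 * u) * n \<le> 2" using pos le1 by (simp add: distrib_left)
    ultimately show ?thesis using u(1) Bs B eB by (intro L(2)[of u B "real n"]) auto
  qed
  then show ?thesis using L(1) v(1) by (auto simp: delta2_zero_def)
qed

lemma upper_monotone_imp_suitable_delta2:
  assumes sp: "admissible_space M Ona A"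
    and K: "\<forall>x\<in>E_Phi M \<Phi>. \<not> (AE t in M. x t = 0) \<longrightarrow> K_set M \<Phi> p x \<noteq> {}"
    and ulm: "upper_locally_uniformly_monotone M (E_Phi M \<Phi>) N"
  shows "a_Phi \<Phi> = 0 \<and> suitable_delta2 M Ona A \<Phi>"
proof
  have sf: "sigma_finite_measure M" and Ona: "Ona \<in> sets M" and na: "nonatomic_on M Ona"
    and atom: "\<And>a. a \<in> A \<Longrightarrow> {a} \<in> sets M \<and> emeasure M {a} = 1"
    and kind: "0 < emeasure M Ona \<or> infinite A"
    using sp by (auto simp: admissible_space_def)
  show "suitable_delta2 M Ona A \<Phi>"
    unfolding suitable_delta2_def
    using upper_monotone_imp_nonatomic_delta2[OF K ulm na sf Ona]
      upper_monotone_imp_delta2_zero[OF K ulm _ atom] by blast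
  show "a_Phi \<Phi> = 0"
  \<comment> \<open>Two disjoint sets of positive finite measure are needed: pieces of the
    non-atomic part, or else two distinct atoms.\<close>
  proof (cases "0 < emeasure M Ona")
    case True
    from nonatomic_split[OF na sf Ona this] show ?thesis
      using upper_monotone_imp_a_Phi_zero[OF K ulm] by metis
  next
    case False
    then have inf: "infinite A" using kind by blast
    then obtain a where a: "a \<in> A" by (metis finite.emptyI ex_in_conv)
    have "infinite (A - {a})" using inf by simp
    then obtain b where b: "b \<in> A" "b \<noteq> a" by (metis finite.emptyI ex_in_conv DiffE singletonI)
    show ?thesis
      using upper_monotone_imp_a_Phi_zero[OF K ulm, of "{a}" "{b}"] atom[OF a] atom[OF b(1)] b(2) by simp
  qed
qed

end

theorem theorem9:
  fixes M :: "'a measure" and Ona A :: "'a set"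
    and \<Phi> :: "real \<Rightarrow> real" and p :: "real \<times> real \<Rightarrow> real"
  assumes space: "admissible_space M Ona A"
    and p_norm: "lattice_norm_R2 p" and p_strict: "strictly_monotone_R2 p"
    and p_e1: "p (1, 0) = 1" and p_e2: "p (0, 1) = 1"
    and Phi: "orlicz_function \<Phi>"
  defines "N \<equiv> orlicz_norm M \<Phi> p"
  shows "((a_Phi \<Phi> = 0 \<and> suitable_delta2 M Ona A \<Phi>) \<longrightarrow> uniformly_monotone M (L_Phi M \<Phi>) N)
       \<and> (uniformly_monotone M (L_Phi M \<Phi>) N \<longrightarrow> upper_locally_uniformly_monotone M (L_Phi M \<Phi>) N)
       \<and> (upper_locally_uniformly_monotone M (L_Phi M \<Phi>) N \<longrightarrow> upper_locally_uniformly_monotone M (E_Phi M \<Phi>) N)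
       \<and> ((\<forall>x\<in>E_Phi M \<Phi>. \<not> (AE t in M. x t = 0) \<longrightarrow> K_set M \<Phi> p x \<noteq> {}) \<longrightarrow>
            (upper_locally_uniformly_monotone M (E_Phi M \<Phi>) N \<longrightarrow> (a_Phi \<Phi> = 0 \<and> suitable_delta2 M Ona A \<Phi>)))"
proof -
  interpret orlicz_amemiya M \<Phi> p
    using p_norm p_e1 p_e2 Phi by unfold_locales
  have "upper_locally_uniformly_monotone M (E_Phi M \<Phi>) (orlicz_norm M \<Phi> p)"
    if "upper_locally_uniformly_monotone M (L_Phi M \<Phi>) (orlicz_norm M \<Phi> p)"
    using that E_subset_L unfolding upper_locally_uniformly_monotone_def by (meson subsetD)
  then show ?thesis
    unfolding N_def
    using delta2_imp_uniformly_monotone[OF space p_strict] uniformly_monotone_imp_upper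
      upper_monotone_imp_suitable_delta2[OF space] by blast
qed

end
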